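(* Let $\lambda$ be any partition, and let $\mathcal{D}^*(\lambda)$, $\mathcal{U}(\lambda)$, $\omega_\lambda$, $\overline{\omega}_\lambda$, $\mathcal{P}_\lambda$, $\overline{\mathcal{P}}_\lambda$ be as defined in the context. Then: (1) For each $\mu \in \mathcal{D}^*(\lambda)$, $$\sum_{\nu \in \mathcal{U}(\lambda)} \mathcal{P}_\lambda(\mu \rightarrow \nu) = 1,$$ and for each $\nu \in \mathcal{U}(\lambda)$, $$\sum_{\mu \in \mathcal{D}^*(\lambda)} \overline{\mathcal{P}}_\lambda(\mu \leftarrow \nu) = 1.$$ (2) For all $\mu \in \mathcal{D}^*(\lambda)$ and $\nu \in \mathcal{U}(\lambda)$, $$\omega_\lambda(\mu)\, \mathcal{P}_\lambda(\mu \rightarrow \nu) = \overline{\mathcal{P}}_\lambda(\mu \leftarrow \nu)\, \overline{\omega}_\lambda(\nu).$$ Thus the expressions $\mathcal{P}_\lambda$ and $\overline{\mathcal{P}}_\lambda$ define a probabilistic bijection from $(\mathcal{D}^*(\lambda), \omega_\lambda)$ to $(\mathcal{U}(\lambda), \overline{\omega}_\lambda)$.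
   Context: All expressions are elements of the field $\mathbb{Q}(q,t)$ of rational functions in $q$ and $t$. A partition $\kappa$ is identified with its Young diagram, the set of cells (row $r$, column $c$) with $r \geq 1$, $1 \le c \le \kappa_r$. Diagrams are drawn in French notation: row 1 (the longest row, of length $\kappa_1$) is at the bottom, rows are numbered from bottom to top, and columns from left to right. Write $\mu \lessdot \lambda$ if $\mu \subseteq \lambda$ and $|\lambda/\mu| = 1$. Set $\mathcal{D}(\lambda) = \{\mu : \mu \lessdot \lambda\}$, $\mathcal{U}(\lambda) = \{\nu : \lambda \lessdot \nu\}$, and $\mathcal{D}^*(\lambda) = \mathcal{D}(\lambda) \cup \{\lambda\}$. For a cell $c \in \kappa$, the arm-length $a_\kappa(c)$ (resp. leg-length $\ell_\kappa(c)$) is the number of cells of $\kappa$ strictly to the right of $c$ in its row (resp. strictly above $c$ in its column). Define $$[h_\kappa(c)]^\ell = 1 - q^{a_\kappa(c)} t^{\ell_\kappa(c)+1}, \qquad [h_\kappa(c)]^a = 1 - q^{a_\kappa(c)+1} t^{\ell_\kappa(c)}, \qquad b_\kappa(c) = \frac{[h_\kappa(c)]^\ell}{[h_\kappa(c)]^a}.$$ For $\rho \subseteq \kappa$, let $\mathcal{R}_{\kappa/\rho}$ (resp. $\mathcal{C}_{\kappa/\rho}$) be the set of all cells of $\rho$ lying in a row (resp. column) that contains a cell of $\kappa/\rho$. Weights: $\omega_\lambda : \mathcal{D}^*(\lambda) \to \mathbb{Q}(q,t)$ and $\overline{\omega}_\lambda : \mathcal{U}(\lambda) \to \mathbb{Q}(q,t)$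 are defined by $\omega_\lambda(\lambda) = 1$, $$\omega_\lambda(\mu) = \prod_{c \in \mathcal{R}_{\lambda/\mu}} \frac{b_\mu(c)}{b_\lambda(c)} \prod_{c \in \mathcal{C}_{\lambda/\mu}} \frac{b_\lambda(c)}{b_\mu(c)} \quad (\mu \in \mathcal{D}(\lambda)), \qquad \overline{\omega}_\lambda(\nu) = \prod_{c \in \mathcal{R}_{\nu/\lambda}} \frac{b_\lambda(c)}{b_\nu(c)} \prod_{c \in \mathcal{C}_{\nu/\lambda}} \frac{b_\nu(c)}{b_\lambda(c)}.$$ For partitions $\rho \lessdot \kappa$, define $$\alpha_{\kappa/\rho} = \prod_{c \in \mathcal{R}_{\kappa/\rho}} \frac{[h_\rho(c)]^\ell}{[h_\kappa(c)]^\ell} \prod_{c \in \mathcal{C}_{\kappa/\rho}} \frac{[h_\rho(c)]^a}{[h_\kappa(c)]^a}, \qquad \overline{\alpha}_{\kappa/\rho} = \prod_{c \in \mathcal{R}_{\kappa/\rho}} \frac{[h_\rho(c)]^a}{[h_\kappa(c)]^a} \prod_{c \in \mathcal{C}_{\kappa/\rho}} \frac{[h_\rho(c)]^\ell}{[h_\kappa(c)]^\ell}.$$ For $\nu \in \mathcal{U}(\lambda)$ and $\mu \in \mathcal{D}(\lambda)$, let the cell $\nu/\lambda$ be in row $r_\nu$ and column $c_\nu$, and the cell $\lambda/\mu$ in row $r_\mu$ and column $c_\mu$, and set $$\eta_{\nu/\lambda/\mu} = \frac{(1-q)(1-t)}{(1-q^{c_\mu-c_\nu}t^{r_\nu-r_\mu})(1-q^{c_\mu-c_\nu+1}t^{r_\nu-r_\mu-1})}.$$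 Define $$\mathcal{P}_\lambda(\lambda \rightarrow \nu) = t^{r_\nu-1}\alpha_{\nu/\lambda}, \qquad \mathcal{P}_\lambda(\mu \rightarrow \nu) = t^{r_\nu-r_\mu-1}\frac{\alpha_{\nu/\lambda}}{\alpha_{\lambda/\mu}}\eta_{\nu/\lambda/\mu} \quad (\mu \in \mathcal{D}(\lambda)),$$ $$\overline{\mathcal{P}}_\lambda(\lambda \leftarrow \nu) = t^{r_\nu-1}\overline{\alpha}_{\nu/\lambda}, \qquad \overline{\mathcal{P}}_\lambda(\mu \leftarrow \nu) = t^{r_\nu-r_\mu-1}\frac{\overline{\alpha}_{\nu/\lambda}}{\overline{\alpha}_{\lambda/\mu}}\eta_{\nu/\lambda/\mu} \quad (\mu \in \mathcal{D}(\lambda)).$$ Probabilistic bijection: given finite sets $X, Y$ with weight functions $\omega : X \to k$, $\overline{\omega} : Y \to k$ ($k$ a field), a probabilistic bijection from $(X,\omega)$ to $(Y,\overline{\omega})$ is a pair of maps $\mathcal{P}, \overline{\mathcal{P}} : X \times Y \to k$, written $\mathcal{P}(x \to y)$ and $\overline{\mathcal{P}}(x \leftarrow y)$, such that $\sum_{y \in Y} \mathcal{P}(x \to y) = 1$ for each $x \in X$, $\sum_{x \in X} \overline{\mathcal{P}}(x \leftarrow y) = 1$ for each $y \in Y$, and $\omega(x)\mathcal{P}(x \to y) = \overline{\mathcal{P}}(x \leftarrow y)\overline{\omega}(y)$ for all $x \in X$, $y \in Y$. (Values need not lie in $[0,1]$.) *)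

theory Defs
  imports Complex_Main "HOL-Computational_Algebra.Fraction_Field"
    "HOL-Computational_Algebra.Polynomial"
begin

text \<open>The field \<open>\<rat>(q,t)\<close> is the fraction field of \<open>\<rat>[q][t]\<close>: the coefficient ring of the outer
  polynomials is \<open>\<rat>[q]\<close>, and the outer indeterminate is \<open>t\<close>.\<close>

type_synonym ratfun = "rat poly poly fract"

definition var_q :: ratfun where
  "var_q = Fraction_Field.Fract [:[:0, 1:]:] 1"

definition var_t :: ratfun where
  "var_t = Fraction_Field.Fract [:0, 1:] 1"

text \<open>A partition is a function whose value at \<open>r \<ge> 1\<close> is its \<open>r\<close>-th part. The index \<open>0\<close> carries
  no part; it is normalised to \<open>0\<close> so that each partition has exactly one representation.\<close>

type_synonym parts = "nat \<Rightarrow> nat"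

definition is_partition :: "parts \<Rightarrow> bool" where
  "is_partition \<kappa> \<longleftrightarrow> \<kappa> 0 = 0 \<and> (\<forall>r\<ge>1. \<kappa> (Suc r) \<le> \<kappa> r) \<and> finite {r. \<kappa> r \<noteq> 0}"

text \<open>Cells are pairs (row, column), both counted from 1. In French notation, ``above'' means a
  larger row index.\<close>

type_synonym cell = "nat \<times> nat"

definition diagram :: "parts \<Rightarrow> cell set" where
  "diagram \<kappa> = {(r, c). r \<ge> 1 \<and> 1 \<le> c \<and> c \<le> \<kappa> r}"

definition covered_by :: "parts \<Rightarrow> parts \<Rightarrow> bool" where
  "covered_by \<mu> \<kappa> \<longleftrightarrow> is_partition \<mu> \<and> is_partition \<kappa> \<and>
     diagram \<mu> \<subseteq> diagram \<kappa> \<and> card (diagram \<kappa> - diagram \<mu>) = 1"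

definition down_set :: "parts \<Rightarrow> parts set" where
  "down_set lam = {\<mu>. covered_by \<mu> lam}"

definition up_set :: "parts \<Rightarrow> parts set" where
  "up_set lam = {\<nu>. covered_by lam \<nu>}"

definition down_star :: "parts \<Rightarrow> parts set" where
  "down_star lam = down_set lam \<union> {lam}"

text \<open>The unique cell of \<open>\<kappa>/\<rho>\<close>; meaningful only if \<open>\<rho>\<close> is covered by \<open>\<kappa>\<close>.\<close>

definition skew_cell :: "parts \<Rightarrow> parts \<Rightarrow> cell" where
  "skew_cell \<kappa> \<rho> = the_elem (diagram \<kappa> - diagram \<rho>)"

definition skew_row :: "parts \<Rightarrow> parts \<Rightarrow> int" where
  "skew_row \<kappa> \<rho> = int (fst (skew_cell \<kappa> \<rho>))"

definition skew_col :: "parts \<Rightarrow> parts \<Rightarrow> int" where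
  "skew_col \<kappa> \<rho> = int (snd (skew_cell \<kappa> \<rho>))"

definition arm :: "parts \<Rightarrow> cell \<Rightarrow> nat" where
  "arm \<kappa> x = card {y \<in> diagram \<kappa>. fst y = fst x \<and> snd y > snd x}"

definition leg :: "parts \<Rightarrow> cell \<Rightarrow> nat" where
  "leg \<kappa> x = card {y \<in> diagram \<kappa>. snd y = snd x \<and> fst y > fst x}"

definition hook_leg :: "parts \<Rightarrow> cell \<Rightarrow> ratfun" where
  "hook_leg \<kappa> x = 1 - var_q ^ arm \<kappa> x * var_t ^ (leg \<kappa> x + 1)"

definition hook_arm :: "parts \<Rightarrow> cell \<Rightarrow> ratfun" where
  "hook_arm \<kappa> x = 1 - var_q ^ (arm \<kappa> x + 1) * var_t ^ leg \<kappa> x"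

definition b_cell :: "parts \<Rightarrow> cell \<Rightarrow> ratfun" where
  "b_cell \<kappa> x = hook_leg \<kappa> x / hook_arm \<kappa> x"

definition row_cells :: "parts \<Rightarrow> parts \<Rightarrow> cell set" where
  "row_cells \<kappa> \<rho> = {x \<in> diagram \<rho>. \<exists>y \<in> diagram \<kappa> - diagram \<rho>. fst y = fst x}"

definition col_cells :: "parts \<Rightarrow> parts \<Rightarrow> cell set" where
  "col_cells \<kappa> \<rho> = {x \<in> diagram \<rho>. \<exists>y \<in> diagram \<kappa> - diagram \<rho>. snd y = snd x}"

definition weight_down :: "parts \<Rightarrow> parts \<Rightarrow> ratfun" where
  "weight_down lam \<mu> =
     (if \<mu> = lam then 1
      else (\<Prod>x\<in>row_cells lam \<mu>. b_cell \<mu> x / b_cell lam x) *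
           (\<Prod>x\<in>col_cells lam \<mu>. b_cell lam x / b_cell \<mu> x))"

definition weight_up :: "parts \<Rightarrow> parts \<Rightarrow> ratfun" where
  "weight_up lam \<nu> =
     (\<Prod>x\<in>row_cells \<nu> lam. b_cell lam x / b_cell \<nu> x) *
     (\<Prod>x\<in>col_cells \<nu> lam. b_cell \<nu> x / b_cell lam x)"

definition alpha :: "parts \<Rightarrow> parts \<Rightarrow> ratfun" where
  "alpha \<kappa> \<rho> =
     (\<Prod>x\<in>row_cells \<kappa> \<rho>. hook_leg \<rho> x / hook_leg \<kappa> x) *
     (\<Prod>x\<in>col_cells \<kappa> \<rho>. hook_arm \<rho> x / hook_arm \<kappa> x)"

definition alpha_bar :: "parts \<Rightarrow> parts \<Rightarrow> ratfun" where
  "alpha_bar \<kappa> \<rho> =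
     (\<Prod>x\<in>row_cells \<kappa> \<rho>. hook_arm \<rho> x / hook_arm \<kappa> x) *
     (\<Prod>x\<in>col_cells \<kappa> \<rho>. hook_leg \<rho> x / hook_leg \<kappa> x)"

text \<open>The exponents may be negative, hence integer powers \<open>powi\<close>.\<close>

definition eta :: "parts \<Rightarrow> parts \<Rightarrow> parts \<Rightarrow> ratfun" where
  "eta \<nu> lam \<mu> =
     (let r\<^sub>\<nu> = skew_row \<nu> lam; c\<^sub>\<nu> = skew_col \<nu> lam;
          r\<^sub>\<mu> = skew_row lam \<mu>; c\<^sub>\<mu> = skew_col lam \<mu>
      in (1 - var_q) * (1 - var_t) /
         ((1 - var_q powi (c\<^sub>\<mu> - c\<^sub>\<nu>) * var_t powi (r\<^sub>\<nu> - r\<^sub>\<mu>)) *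
          (1 - var_q powi (c\<^sub>\<mu> - c\<^sub>\<nu> + 1) * var_t powi (r\<^sub>\<nu> - r\<^sub>\<mu> - 1))))"

text \<open>\<open>P_fwd lam \<mu> \<nu>\<close> is the unbarred expression for \<open>\<mu> \<rightarrow> \<nu>\<close> and \<open>P_bwd lam \<mu> \<nu>\<close> is the barred
  expression for \<open>\<mu> \<leftarrow> \<nu>\<close>, both for the base partition \<open>lam\<close>.\<close>

definition P_fwd :: "parts \<Rightarrow> parts \<Rightarrow> parts \<Rightarrow> ratfun" where
  "P_fwd lam \<mu> \<nu> =
     (if \<mu> = lam then var_t powi (skew_row \<nu> lam - 1) * alpha \<nu> lam
      else var_t powi (skew_row \<nu> lam - skew_row lam \<mu> - 1) *
           (alpha \<nu> lam / alpha lam \<mu>) * eta \<nu> lam \<mu>)"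

definition P_bwd :: "parts \<Rightarrow> parts \<Rightarrow> parts \<Rightarrow> ratfun" where
  "P_bwd lam \<mu> \<nu> =
     (if \<mu> = lam then var_t powi (skew_row \<nu> lam - 1) * alpha_bar \<nu> lam
      else var_t powi (skew_row \<nu> lam - skew_row lam \<mu> - 1) *
           (alpha_bar \<nu> lam / alpha_bar lam \<mu>) * eta \<nu> lam \<mu>)"

definition probabilistic_bijection ::
  "'a set \<Rightarrow> ('a \<Rightarrow> 'k::field) \<Rightarrow> 'b set \<Rightarrow> ('b \<Rightarrow> 'k) \<Rightarrow>
   ('a \<Rightarrow> 'b \<Rightarrow> 'k) \<Rightarrow> ('a \<Rightarrow> 'b \<Rightarrow> 'k) \<Rightarrow> bool" where
  "probabilistic_bijection X w Y w' P P' \<longleftrightarrow>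
     finite X \<and> finite Y \<and>
     (\<forall>x\<in>X. (\<Sum>y\<in>Y. P x y) = 1) \<and>
     (\<forall>y\<in>Y. (\<Sum>x\<in>X. P' x y) = 1) \<and>
     (\<forall>x\<in>X. \<forall>y\<in>Y. w x * P x y = P' x y * w' y)"

end

theory Submission
  imports Defs
begin

text \<open>
  Cells are replaced by monomials: the cell in column \<open>c\<close> and row \<open>r\<close> becomes the point
  \<open>q\<^sup>-\<^sup>c t\<^sup>r\<close>. Adding or removing a cell changes only hooks in the row and column of that cell. Along
  these, the quotients of old and new hooks telescope over consecutive columns of equal height and
  consecutive rows of equal length, and only the corners of the diagram remain
  (\<open>alpha_eq_boundary_prod\<close>, \<open>boundary_prod_addable\<close>, \<open>boundary_prod_removable\<close>). Let \<open>y\<^sub>0, \<dots>, y\<^sub>d\<close> be the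
  points of the addable cells of \<open>\<lambda>\<close>, and \<open>z\<^sub>1, \<dots>, z\<^sub>d\<close> the points of the diagonal neighbours of
  its removable cells.

  Put \<open>f\<^sub>k(x) = \<Prod>\<^sub>j (x - z\<^sub>j) / \<Prod>\<^sub>j\<^sub>\<noteq>\<^sub>k (x - y\<^sub>j)\<close>. If the \<open>k\<close>-th addable cell is in row \<open>r\<close>, then its addition
  gives \<open>t\<^sup>r\<^sup>-\<^sup>1 \<alpha> = f\<^sub>k(y\<^sub>k)\<close>, and the barred version of \<open>\<alpha>\<close> gives the value of \<open>f\<^sub>k\<close> at the point of the
  diagonal neighbour of that cell. The removal of a cell gives similar quotients, with the product over
  all \<open>y\<^sub>j\<close> and over all but one of the \<open>z\<^sub>j\<close>.

  The sums of probabilities thereby become instances of Lagrange interpolation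
  (\<open>lagrange_leading_coeff\<close>): \<open>\<Sum>\<^sub>k N(y\<^sub>k) / \<Prod>\<^sub>j\<^sub>\<noteq>\<^sub>k (y\<^sub>k - y\<^sub>j)\<close> is the coefficient of degree \<open>d\<close> in the
  polynomial \<open>N\<close>. For the transitions out of \<open>\<lambda>\<close> this coefficient is one because \<open>N\<close> is monic of
  degree \<open>d\<close>. For the transitions out of a lower cover \<open>\<mu>\<close>, the two linear factors in the denominator of
  \<open>\<eta>\<close> cancel one \<open>z\<^sub>j\<close> and add a new node at the removed cell; the coefficient is zero and the term
  of the new node gives the normalisation. The barred sums over lower covers are a partial fraction expansion
  in which the \<open>z\<^sub>j\<close> are the nodes (\<open>interlacing_partial_fractions\<close>).

  The balance condition needs no summation: the weights are the quotients of \<open>\<alpha>\<close> by its barred version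
  (\<open>weight_up_eq_alpha_ratio\<close>, \<open>weight_down_eq_alpha_ratio\<close>).
\<close>

section \<open>Lagrange interpolation and coefficient extraction\<close>

text \<open>Interpolating a polynomial \<open>N\<close> of degree below the number of nodes \<open>y i\<close> reproduces \<open>N\<close>.
Each Lagrange basis polynomial is a multiple of a monic polynomial of degree \<open>card A - 1\<close>, so the
left-hand side is the coefficient of that degree in the interpolant.\<close>

lemma lagrange_leading_coeff:
  fixes y :: "'i \<Rightarrow> 'a::field"
  assumes fin: "finite A" and inj: "inj_on y A" and deg: "degree N < card A"
  shows "(\<Sum>i\<in>A. poly N (y i) / (\<Prod>j\<in>A - {i}. y i - y j)) = coeff N (card A - 1)"
proof -
  define \<pi> where "\<pi> i = (\<Prod>j\<in>A - {i}. [:- y j, 1:])" for i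
  define \<gamma> where "\<gamma> i = poly N (y i) / (\<Prod>j\<in>A - {i}. y i - y j)" for i
  define L where "L = (\<Sum>i\<in>A. smult (\<gamma> i) (\<pi> i))"
  have pi_deg: "degree (\<pi> i) = card A - 1" and pi_lead: "coeff (\<pi> i) (card A - 1) = 1"
    if "i \<in> A" for i
  proof -
    have "degree (\<pi> i) = (\<Sum>j\<in>A - {i}. degree [:- y j, 1:])"
      unfolding \<pi>_def by (intro degree_prod_eq_sum_degree) auto
    then show d: "degree (\<pi> i) = card A - 1"
      using fin that by simp
    have "lead_coeff (\<pi> i) = 1"
      unfolding \<pi>_def by (simp add: lead_coeff_prod)
    then show "coeff (\<pi> i) (card A - 1) = 1"
      using d by simp
  qed
  have pi_eval: "poly (\<pi> i) x = (\<Prod>j\<in>A - {i}. x - y j)" for i x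
    by (simp add: \<pi>_def poly_prod)
  have "degree L \<le> card A - 1"
    unfolding L_def using fin
  proof (rule degree_sum_le)
    fix i assume "i \<in> A"
    then show "degree (smult (\<gamma> i) (\<pi> i)) \<le> card A - 1"
      using degree_smult_le[of "\<gamma> i" "\<pi> i"] by (simp add: pi_deg)
  qed
  then have degL: "degree L < card A"
    using deg by linarith
  have "poly L (y k) = poly N (y k)" if k: "k \<in> A" for k
  proof -
    have z: "\<gamma> i * poly (\<pi> i) (y k) = 0" if "i \<in> A - {k}" for i
      using that k fin unfolding pi_eval by (auto intro: prod_zero)
    have "poly L (y k) = (\<Sum>i\<in>A. \<gamma> i * poly (\<pi> i) (y k))"
      by (simp add: L_def poly_sum)
    also have "\<dots> = \<gamma> k * poly (\<pi> k) (y k)"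
      using fin k sum.neutral[of "A - {k}" "\<lambda>i. \<gamma> i * poly (\<pi> i) (y k)"] z
      by (simp add: sum.remove[of A k] del: mult_eq_0_iff)
    also have "\<dots> = poly N (y k)"
    proof -
      have "(\<Prod>j\<in>A - {k}. y k - y j) \<noteq> 0"
        using fin inj k by (auto simp: inj_on_def)
      then show ?thesis by (simp add: \<gamma>_def pi_eval)
    qed
    finally show ?thesis .
  qed
  then have "N = L"
    using deg degL inj by (intro poly_eqI_degree[of "y ` A"]) (auto simp: card_image)
  then have "coeff N (card A - 1) = (\<Sum>i\<in>A. \<gamma> i * coeff (\<pi> i) (card A - 1))"
    by (simp add: L_def coeff_sum)
  also have "\<dots> = (\<Sum>i\<in>A. \<gamma> i)"
    using pi_lead by (intro sum.cong) auto
  finally show ?thesis by (simp add: \<gamma>_def)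
qed

text \<open>The previous lemma with one more node \<open>w\<close>, written separately because it plays a different role
from the nodes \<open>y i\<close> in the applications.\<close>

lemma lagrange_leading_coeff_extra:
  fixes y :: "'i \<Rightarrow> 'a::field"
  assumes fin: "finite A" and inj: "inj_on y A" and w: "w \<notin> y ` A" and deg: "degree N \<le> card A"
  shows "poly N w / (\<Prod>j\<in>A. w - y j)
           + (\<Sum>i\<in>A. poly N (y i) / ((\<Prod>j\<in>A - {i}. y i - y j) * (y i - w))) = coeff N (card A)"
proof -
  define f where "f = case_option w y"
  define S where "S = insert None (Some ` A)"
  have cS: "card S = Suc (card A)"
    using fin by (auto simp: S_def card_insert_if card_image)
  have injf: "inj_on f S"
    using inj w by (auto simp: f_def S_def inj_on_def)
  have e: "(\<Sum>i\<in>S. poly N (f i) / (\<Prod>j\<in>S - {i}. f i - f j)) = coeff N (card A)"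
    using lagrange_leading_coeff[of S f N] fin injf deg cS by (simp add: S_def)
  have n: "S - {None} = Some ` A"
    by (auto simp: S_def)
  have s: "(\<Prod>j\<in>S - {Some i}. f (Some i) - f j) = (\<Prod>j\<in>A - {i}. y i - y j) * (y i - w)" for i
  proof -
    have "S - {Some i} = insert None (Some ` (A - {i}))"
      by (auto simp: S_def)
    then show ?thesis
      using fin by (simp add: f_def prod.reindex mult.commute)
  qed
  have "(\<Sum>i\<in>S. poly N (f i) / (\<Prod>j\<in>S - {i}. f i - f j))
      = poly N (f None) / (\<Prod>j\<in>S - {None}. f None - f j)
        + (\<Sum>i\<in>Some ` A. poly N (f i) / (\<Prod>j\<in>S - {i}. f i - f j))"
    using fin by (subst S_def, subst sum.insert) auto
  also have "\<dots> = poly N w / (\<Prod>j\<in>A. w - y j)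
        + (\<Sum>i\<in>A. poly N (y i) / ((\<Prod>j\<in>A - {i}. y i - y j) * (y i - w)))"
    unfolding n by (simp add: sum.reindex prod.reindex s) (simp add: f_def)
  finally show ?thesis using e by simp
qed

lemma monic_prod:
  fixes z :: "'i \<Rightarrow> 'a::field"
  assumes "finite B"
  shows "degree (\<Prod>b\<in>B. [:- z b, 1:]) = card B" and "coeff (\<Prod>b\<in>B. [:- z b, 1:]) (card B) = 1"
    and "poly (\<Prod>b\<in>B. [:- z b, 1:]) x = (\<Prod>b\<in>B. x - z b)"
proof -
  have "degree (\<Prod>b\<in>B. [:- z b, 1:]) = (\<Sum>b\<in>B. degree [:- z b, 1:])"
    by (intro degree_prod_eq_sum_degree) auto
  then show d: "degree (\<Prod>b\<in>B. [:- z b, 1:]) = card B"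
    by simp
  have "lead_coeff (\<Prod>b\<in>B. [:- z b, 1:]) = 1"
    by (simp add: lead_coeff_prod)
  then show "coeff (\<Prod>b\<in>B. [:- z b, 1:]) (card B) = 1"
    using d by simp
  show "poly (\<Prod>b\<in>B. [:- z b, 1:]) x = (\<Prod>b\<in>B. x - z b)"
    by (simp add: poly_prod)
qed

text \<open>The numerator is monic with degree exactly one less than the number of nodes. This is what makes the
transition probabilities out of \<open>\<lambda>\<close> itself sum to one.\<close>

lemma interlacing_sum:
  fixes y :: "'i \<Rightarrow> 'a::field" and z :: "'j \<Rightarrow> 'a"
  assumes "finite A" "inj_on y A" "finite B" "card A = Suc (card B)"
  shows "(\<Sum>i\<in>A. (\<Prod>b\<in>B. y i - z b) / (\<Prod>j\<in>A - {i}. y i - y j)) = 1"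
  using lagrange_leading_coeff[of A y "\<Prod>b\<in>B. [:- z b, 1:]"] assms
  by (simp add: monic_prod)

text \<open>After the factor \<open>y i - z m\<close> is cancelled, the numerator has degree \<open>card A - 2\<close>, which is too
small to contribute to the coefficient extracted by interpolation at the nodes \<open>y i\<close> and \<open>w\<close>. The
sum over all nodes vanishes, and the right-hand side is the negative of the term of \<open>w\<close>.\<close>

lemma interlacing_sum_removed:
  fixes y :: "'i \<Rightarrow> 'a::field" and z :: "'j \<Rightarrow> 'a"
  assumes A: "finite A" "inj_on y A" and B: "finite B" "card A = Suc (card B)" "m \<in> B"
    and w: "w \<notin> y ` A" and z: "z m \<notin> y ` A"
  shows "(\<Sum>i\<in>A. (\<Prod>b\<in>B. y i - z b) / (\<Prod>j\<in>A - {i}. y i - y j) / ((y i - w) * (y i - z m)))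
       = - ((\<Prod>b\<in>B - {m}. w - z b) / (\<Prod>j\<in>A. w - y j))"
proof -
  let ?N = "\<Prod>b\<in>B - {m}. [:- z b, 1:]"
  have "degree ?N = card (B - {m})"
    using B by (simp add: monic_prod)
  then have dN: "degree ?N < card A"
    using B card_Diff1_less[of B m] by simp
  have "(\<Sum>i\<in>A. (\<Prod>b\<in>B. y i - z b) / (\<Prod>j\<in>A - {i}. y i - y j) / ((y i - w) * (y i - z m)))
      = (\<Sum>i\<in>A. poly ?N (y i) / ((\<Prod>j\<in>A - {i}. y i - y j) * (y i - w)))"
  proof (rule sum.cong)
    fix i assume i: "i \<in> A"
    have "y i - z m \<noteq> 0" using i z by (metis eq_iff_diff_eq_0 imageI)
    moreover have "(\<Prod>b\<in>B. y i - z b) = (y i - z m) * poly ?N (y i)"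
      using prod.remove[OF B(1,3), of "\<lambda>b. y i - z b"] B(1) by (simp add: monic_prod)
    ultimately show "(\<Prod>b\<in>B. y i - z b) / (\<Prod>j\<in>A - {i}. y i - y j) / ((y i - w) * (y i - z m))
      = poly ?N (y i) / ((\<Prod>j\<in>A - {i}. y i - y j) * (y i - w))"
      by (simp add: mult.commute)
  qed simp
  also have "\<dots> = - (poly ?N w / (\<Prod>j\<in>A. w - y j))"
  proof -
    have "coeff ?N (card A) = 0"
      using dN by (rule coeff_eq_0)
    then show ?thesis
      using lagrange_leading_coeff_extra[OF A w less_imp_le[OF dN]]
      by (simp only: eq_neg_iff_add_eq_0 add.commute)
  qed
  finally show ?thesis using B by (simp add: monic_prod)
qed

text \<open>The partial fraction expansion of a quotient of two monic polynomials of the same degree, whose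
polynomial part is the constant one. It follows from interpolation at the poles together with \<open>x\<close>.\<close>

lemma interlacing_partial_fractions:
  fixes z :: "'j \<Rightarrow> 'a::field" and y :: "'i \<Rightarrow> 'a"
  assumes B: "finite B" "inj_on z B" and C: "finite C" "card C = card B"
    and x: "x \<notin> z ` B"
  shows "(\<Prod>c\<in>C. x - y c) / (\<Prod>b\<in>B. x - z b)
      = 1 - (\<Sum>m\<in>B. (\<Prod>c\<in>C. z m - y c) / ((\<Prod>b\<in>B - {m}. z m - z b) * (z m - x)))"
proof -
  let ?N = "\<Prod>c\<in>C. [:- y c, 1:]"
  have "degree ?N = card B" "coeff ?N (card B) = 1"
    using monic_prod(1,2)[OF C(1), of y] C(2) by simp_all
  then show ?thesis
    using lagrange_leading_coeff_extra[OF B x, of ?N] by (simp add: monic_prod C(1) eq_diff_eq)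
qed

section \<open>Telescoping products\<close>

text \<open>The predicate \<open>Q\<close> marks the starts of the blocks into which \<open>{1..}\<close> is cut. Inside a block the
numerator at \<open>k\<close> cancels the denominator at \<open>k + 1\<close>, so that only the numerators at block ends and
the denominators at block starts survive. If \<open>n\<close> is not the start of a block, the last block is
incomplete and leaves the numerator \<open>G (n - 1) = F n\<close>.\<close>

lemma prod_ratio_telescope:
  fixes F G :: "nat \<Rightarrow> 'a::field"
  assumes n: "1 \<le> n" and Q1: "Q 1"
    and F: "\<And>k. 1 \<le> k \<Longrightarrow> k < n \<Longrightarrow> F k \<noteq> 0"
    and G: "\<And>k. 1 \<le> k \<Longrightarrow> k < n \<Longrightarrow> \<not> Q (Suc k) \<Longrightarrow> G k = F (Suc k)"
  shows "(\<Prod>k\<in>{1..<n}. G k / F k)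
       = (\<Prod>k\<in>{k\<in>{1..<n}. Q (Suc k)}. G k) / (\<Prod>k\<in>{k\<in>{1..<n}. Q k}. F k)
          * (if Q n then 1 else F n)"
  using n F G
proof (induction n rule: nat_induct_at_least)
  case base
  then show ?case using Q1 by simp
next
  case (Suc n)
  have IH: "(\<Prod>k\<in>{1..<n}. G k / F k)
       = (\<Prod>k\<in>{k\<in>{1..<n}. Q (Suc k)}. G k) / (\<Prod>k\<in>{k\<in>{1..<n}. Q k}. F k)
          * (if Q n then 1 else F n)"
    using Suc by simp
  have split: "{k\<in>{1..<Suc n}. R k} = (if R n then insert n {k\<in>{1..<n}. R k} else {k\<in>{1..<n}. R k})" for R
    using Suc(1) by (auto simp: less_Suc_eq)
  have Fn: "F n \<noteq> 0" and Gn: "\<not> Q (Suc n) \<Longrightarrow> G n = F (Suc n)"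
    using Suc by auto
  have "(\<Prod>k\<in>{1..<Suc n}. G k / F k) = (\<Prod>k\<in>{1..<n}. G k / F k) * (G n / F n)"
    using Suc(1) by simp
  also have "\<dots> = (\<Prod>k\<in>{k\<in>{1..<Suc n}. Q (Suc k)}. G k) / (\<Prod>k\<in>{k\<in>{1..<Suc n}. Q k}. F k)
          * (if Q (Suc n) then 1 else F (Suc n))"
    unfolding IH split[of "\<lambda>k. Q (Suc k)"] split[of Q] using Fn Gn by (simp add: mult_ac)
  finally show ?case .
qed

section \<open>Monomials in the field of rational functions\<close>

text \<open>The monomial attached to the cell in column \<open>c\<close> and row \<open>r\<close>. The factors of all hook
products are of the form \<open>1 - u / v\<close> for two such monomials.\<close>

definition monom_pt :: "nat \<Rightarrow> nat \<Rightarrow> ratfun" where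
  "monom_pt c r = var_t ^ r / var_q ^ c"

lemma var_monom: "var_q ^ a * var_t ^ b = Fraction_Field.Fract (monom (monom 1 a) b) 1"
proof -
  have q: "var_q ^ a = Fraction_Field.Fract [:monom 1 a:] 1"
  proof (induction a)
    case 0
    have "[:monom 1 0:] = (1 :: rat poly poly)"
      by simp
    then show ?case by (simp only: power_0 One_fract_def)
  next
    case (Suc a)
    have "[:[:0, 1:]:] * [:monom 1 a:] = [:monom (1::rat) (Suc a):]"
      by (simp add: monom_Suc)
    then have "var_q * Fraction_Field.Fract [:monom 1 a:] 1 = Fraction_Field.Fract [:monom 1 (Suc a):] 1"
      by (simp only: var_q_def mult_fract mult_1_right)
    then show ?case by (simp only: power_Suc Suc)
  qed
  have t: "var_t ^ b = Fraction_Field.Fract (monom 1 b) 1"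
  proof (induction b)
    case 0
    have "monom 1 0 = (1 :: rat poly poly)" by (rule monom_eq_1)
    then show ?case by (simp only: power_0 One_fract_def)
  next
    case (Suc b)
    have "[:0, 1:] * monom 1 b = (monom 1 (Suc b) :: rat poly poly)"
      by (simp add: monom_Suc)
    then have "var_t * Fraction_Field.Fract (monom 1 b) 1 = Fraction_Field.Fract (monom 1 (Suc b)) 1"
      by (simp only: var_t_def mult_fract mult_1_right)
    then show ?case by (simp only: power_Suc Suc)
  qed
  show ?thesis unfolding q t mult_fract by (simp add: smult_monom)
qed

text \<open>The algebraic independence of the two variables, which keeps every hook and every difference of points of
different cells away from zero.\<close>

lemma var_monom_eq_iff:
  "var_q ^ a * var_t ^ b = var_q ^ c * var_t ^ d \<longleftrightarrow> a = c \<and> b = d"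
proof
  assume "var_q ^ a * var_t ^ b = var_q ^ c * var_t ^ d"
  then have "monom (monom (1::rat) a) b = monom (monom 1 c) d"
    by (simp add: var_monom eq_fract)
  then have "coeff (coeff (monom (monom (1::rat) a) b) b) a = coeff (coeff (monom (monom 1 c) d) b) a"
    by simp
  then show "a = c \<and> b = d"
    by (simp split: if_splits)
qed simp

lemma var_nonzero [simp]: "var_q \<noteq> 0" "var_t \<noteq> 0"
  by (simp_all add: var_q_def var_t_def Zero_fract_def eq_fract)

lemma one_minus_monom_nonzero: "(a, b) \<noteq> (0, 0) \<Longrightarrow> 1 - var_q ^ a * var_t ^ b \<noteq> 0"
  using var_monom_eq_iff[of 0 0 a b] by auto

lemma monom_pt_eq_iff [simp]: "monom_pt c r = monom_pt c' r' \<longleftrightarrow> c = c' \<and> r = r'"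
  using var_monom_eq_iff[of c' r c r'] by (auto simp: monom_pt_def divide_simps mult.commute)

lemma monom_pt_nonzero [simp]: "monom_pt c r \<noteq> 0"
  by (simp add: monom_pt_def)

lemma monom_pt_ratio:
  assumes "a \<le> c" "d \<le> b"
  shows "var_q ^ (c - a) * var_t ^ (b - d) = monom_pt a b / monom_pt c d"
  using assms by (simp add: monom_pt_def power_diff field_simps)

section \<open>Partitions, column heights and hooks\<close>

lemma partition_antimono:
  assumes "is_partition lam" "1 \<le> r" "r \<le> s"
  shows "lam s \<le> lam r"
  using assms(3,1,2)
proof (induction s rule: dec_induct)
  case (step n)
  then show ?case
    unfolding is_partition_def by (meson le_trans)
qed simp

definition col_height :: "parts \<Rightarrow> nat \<Rightarrow> nat" where
  "col_height lam c = card {r. 1 \<le> r \<and> c \<le> lam r}"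

text \<open>The column heights form the conjugate partition: both inequalities say that the cell \<open>(r, c)\<close> lies
in the diagram. Every comparison between rows and columns below is read off from this equivalence.\<close>

lemma le_part_iff_le_col_height:
  assumes lam: "is_partition lam" and r: "1 \<le> r" and c: "1 \<le> c"
  shows "c \<le> lam r \<longleftrightarrow> r \<le> col_height lam c"
proof -
  let ?S = "{r. 1 \<le> r \<and> c \<le> lam r}"
  have fin: "finite ?S"
    using lam c by (intro finite_subset[of ?S "{r. lam r \<noteq> 0}"]) (auto simp: is_partition_def)
  show ?thesis
  proof
    assume cr: "c \<le> lam r"
    have "{1..r} \<subseteq> ?S"
    proof
      fix s assume "s \<in> {1..r}"
      then show "s \<in> ?S"
        using cr partition_antimono[OF lam, of s r] by simp
    qed
    then have "card {1..r} \<le> card ?S"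
      by (rule card_mono[OF fin])
    then show "r \<le> col_height lam c"
      by (simp add: col_height_def)
  next
    assume h: "r \<le> col_height lam c"
    show "c \<le> lam r"
    proof (rule ccontr)
      assume cr: "\<not> c \<le> lam r"
      have "?S \<subseteq> {1..<r}"
      proof
        fix s assume "s \<in> ?S"
        then show "s \<in> {1..<r}"
          using cr partition_antimono[OF lam r, of s] by (cases "s < r") auto
      qed
      then have "card ?S \<le> card {1..<r}"
        by (intro card_mono) auto
      then show False using h r by (simp add: col_height_def)
    qed
  qed
qed

lemma diagram_iff: "(r, c) \<in> diagram lam \<longleftrightarrow> 1 \<le> r \<and> 1 \<le> c \<and> c \<le> lam r"
  by (simp add: diagram_def)

lemma arm_eq:
  assumes "1 \<le> r"
  shows "arm lam (r, c) = lam r - c"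
proof -
  have "{y \<in> diagram lam. fst y = r \<and> c < snd y} = Pair r ` {c<..lam r}"
    using assms by (auto simp: diagram_def)
  then show ?thesis
    by (simp add: arm_def card_image inj_on_def)
qed

lemma leg_eq:
  assumes "is_partition lam" "1 \<le> c"
  shows "leg lam (r, c) = col_height lam c - r"
proof -
  have "{y \<in> diagram lam. snd y = c \<and> r < fst y} = (\<lambda>s. (s, c)) ` {r<..col_height lam c}"
    using assms le_part_iff_le_col_height[OF assms(1), of _ c] by (auto simp: diagram_def)
  then show ?thesis
    by (simp add: leg_def card_image inj_on_def)
qed

lemma hook_leg_nonzero [simp]: "hook_leg \<kappa> x \<noteq> 0"
  unfolding hook_leg_def by (rule one_minus_monom_nonzero) simp

lemma hook_arm_nonzero [simp]: "hook_arm \<kappa> x \<noteq> 0"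
  unfolding hook_arm_def by (rule one_minus_monom_nonzero) simp

lemma finite_diagram:
  assumes "is_partition lam"
  shows "finite (diagram lam)"
proof -
  have "diagram lam = Sigma {r. 1 \<le> r \<and> lam r \<noteq> 0} (\<lambda>r. {1..lam r})"
    by (auto simp: diagram_def)
  moreover have "finite {r. 1 \<le> r \<and> lam r \<noteq> 0}"
    using assms by (auto simp: is_partition_def)
  ultimately show ?thesis by simp
qed

lemma alpha_nonzero:
  assumes "is_partition \<rho>"
  shows "alpha \<kappa> \<rho> \<noteq> 0" "alpha_bar \<kappa> \<rho> \<noteq> 0"
  using finite_diagram[OF assms]
  by (auto simp: alpha_def alpha_bar_def row_cells_def col_cells_def)

section \<open>The balance condition\<close>

text \<open>Replacing \<open>\<alpha>\<close> by its barred version exchanges the two kinds of hooks in each factor, and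
\<open>b_cell\<close> is the quotient of these hooks. Hence the weights are the quotients of the two products,
which makes the balance condition an identity that involves no summation.\<close>

lemma weight_up_eq_alpha_ratio: "weight_up lam \<nu> = alpha \<nu> lam / alpha_bar \<nu> lam"
proof -
  have "weight_up lam \<nu> =
    (\<Prod>x\<in>row_cells \<nu> lam. (hook_leg lam x / hook_leg \<nu> x) / (hook_arm lam x / hook_arm \<nu> x)) *
    (\<Prod>x\<in>col_cells \<nu> lam. (hook_arm lam x / hook_arm \<nu> x) / (hook_leg lam x / hook_leg \<nu> x))"
    unfolding weight_up_def b_cell_def
    by (intro arg_cong2[where f = "(*)"] prod.cong) (simp_all add: divide_simps)
  then show ?thesis
    by (simp add: alpha_def alpha_bar_def prod_dividef prod.distrib mult_ac)
qed

lemma weight_down_eq_alpha_ratio: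
  assumes "\<mu> \<noteq> lam"
  shows "weight_down lam \<mu> = alpha lam \<mu> / alpha_bar lam \<mu>"
proof -
  have "weight_down lam \<mu> =
    (\<Prod>x\<in>row_cells lam \<mu>. (hook_leg \<mu> x / hook_leg lam x) / (hook_arm \<mu> x / hook_arm lam x)) *
    (\<Prod>x\<in>col_cells lam \<mu>. (hook_arm \<mu> x / hook_arm lam x) / (hook_leg \<mu> x / hook_leg lam x))"
    unfolding weight_down_def b_cell_def using assms
    by (simp, intro arg_cong2[where f = "(*)"] prod.cong) (simp_all add: divide_simps)
  then show ?thesis
    by (simp add: alpha_def alpha_bar_def prod_dividef prod.distrib mult_ac)
qed

lemma detailed_balance:
  assumes "is_partition lam" "is_partition \<mu>"
  shows "weight_down lam \<mu> * P_fwd lam \<mu> \<nu> = P_bwd lam \<mu> \<nu> * weight_up lam \<nu>"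
proof (cases "\<mu> = lam")
  case True
  then show ?thesis
    using alpha_nonzero[OF assms(1)]
    by (simp add: weight_up_eq_alpha_ratio weight_down_def P_fwd_def P_bwd_def)
next
  case False
  then show ?thesis
    using alpha_nonzero[OF assms(1)] alpha_nonzero[OF assms(2)]
    by (simp add: weight_up_eq_alpha_ratio weight_down_eq_alpha_ratio P_fwd_def P_bwd_def)
qed

section \<open>Covering relations and corner cells\<close>

abbreviation add_cell :: "parts \<Rightarrow> nat \<Rightarrow> parts" where
  "add_cell \<rho> r \<equiv> \<rho>(r := Suc (\<rho> r))"

lemma diagram_add_cell:
  assumes "1 \<le> r"
  shows "diagram (add_cell \<rho> r) - diagram \<rho> = {(r, Suc (\<rho> r))}"
    and "diagram \<rho> \<subseteq> diagram (add_cell \<rho> r)"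
  using assms by (auto simp: diagram_def split: if_splits)

lemma covered_by_iff:
  "covered_by \<rho> \<kappa> \<longleftrightarrow>
     is_partition \<rho> \<and> is_partition \<kappa> \<and> (\<exists>r\<ge>1. \<kappa> = add_cell \<rho> r)"
proof
  assume cov: "covered_by \<rho> \<kappa>"
  then obtain r c where rc: "diagram \<kappa> - diagram \<rho> = {(r, c)}"
    unfolding covered_by_def by (metis card_1_singletonE surj_pair)
  have sub: "diagram \<rho> \<subseteq> diagram \<kappa>" and p: "is_partition \<rho>" "is_partition \<kappa>"
    using cov by (auto simp: covered_by_def)
  have zero: "\<rho> 0 = 0" "\<kappa> 0 = 0"
    using p by (auto simp: is_partition_def)
  have le: "\<rho> s \<le> \<kappa> s" for s
  proof (cases "s = 0 \<or> \<rho> s = 0")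
    case False
    then have "(s, \<rho> s) \<in> diagram \<rho>" by (simp add: diagram_def)
    then show ?thesis using sub by (auto simp: diagram_def)
  qed (use zero in auto)
  have new: "(s, d) = (r, c)" if "1 \<le> s" "\<rho> s < d" "d \<le> \<kappa> s" for s d
  proof -
    have "(s, d) \<in> diagram \<kappa> - diagram \<rho>"
      using that by (simp add: diagram_def)
    then show ?thesis by (simp add: rc)
  qed
  have "(r, c) \<in> diagram \<kappa> - diagram \<rho>"
    by (simp add: rc)
  then have r: "1 \<le> r" "\<rho> r < c" "c \<le> \<kappa> r"
    by (auto simp: diagram_def)
  have "\<kappa> r = Suc (\<rho> r)"
    using new[of r "\<kappa> r"] new[of r "Suc (\<rho> r)"] r by simp
  moreover have "\<kappa> s = \<rho> s" if "s \<noteq> r" for s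
    using new[of s "\<kappa> s"] le[of s] that zero by (cases "s = 0"; cases "\<rho> s < \<kappa> s") auto
  ultimately have "\<kappa> = add_cell \<rho> r" by auto
  then show "is_partition \<rho> \<and> is_partition \<kappa> \<and> (\<exists>r\<ge>1. \<kappa> = add_cell \<rho> r)"
    using p r by blast
next
  assume "is_partition \<rho> \<and> is_partition \<kappa> \<and> (\<exists>r\<ge>1. \<kappa> = add_cell \<rho> r)"
  then obtain r where r: "1 \<le> r" "\<kappa> = add_cell \<rho> r" and p: "is_partition \<rho>" "is_partition \<kappa>"
    by blast
  then show "covered_by \<rho> \<kappa>"
    using diagram_add_cell[OF r(1), of \<rho>] by (simp add: covered_by_def)
qed

lemma skew_add_cell:
  assumes "1 \<le> r"
  shows "skew_row (add_cell \<rho> r) \<rho> = int r" "skew_col (add_cell \<rho> r) \<rho> = int (Suc (\<rho> r))"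
  using diagram_add_cell(1)[OF assms] by (simp_all add: skew_row_def skew_col_def skew_cell_def)

text \<open>A partition has at most one addable and one removable cell in each row, so the upper and lower covers
are indexed by sets of rows. Applied to \<open>col_height lam\<close> in place of \<open>lam\<close>, the same definitions index
the corner cells by their columns.\<close>

definition add_rows :: "parts \<Rightarrow> nat set" where
  "add_rows lam = {r. 1 \<le> r \<and> (r = 1 \<or> lam r < lam (r - 1))}"

definition rem_rows :: "parts \<Rightarrow> nat set" where
  "rem_rows lam = {r. 1 \<le> r \<and> lam (Suc r) < lam r}"

text \<open>Addable and removable cells alternate along the boundary: directly above each removable corner the
next row admits a new cell, and one more cell can be added in the first row. So there is exactly one
more addable cell than there are removable cells.\<close>

lemma add_rows_eq: "add_rows lam = insert 1 (Suc ` rem_rows lam)"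
proof -
  have "r \<in> Suc ` rem_rows lam" if "1 \<le> r" "r \<noteq> 1" "lam r < lam (r - 1)" for r
    using that by (intro image_eqI[of _ _ "r - 1"]) (auto simp: rem_rows_def)
  then show ?thesis
    by (auto simp: add_rows_def rem_rows_def)
qed

lemma finite_rem_rows: "is_partition lam \<Longrightarrow> finite (rem_rows lam)"
  by (rule finite_subset[of _ "{r. lam r \<noteq> 0}"]) (auto simp: rem_rows_def is_partition_def)

lemma finite_add_rows: "is_partition lam \<Longrightarrow> finite (add_rows lam)"
  by (simp add: add_rows_eq finite_rem_rows)

lemma card_add_rows:
  assumes "is_partition lam"
  shows "card (add_rows lam) = Suc (card (rem_rows lam))"
proof -
  have "1 \<notin> Suc ` rem_rows lam" by (auto simp: rem_rows_def)
  then show ?thesis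
    by (simp add: add_rows_eq finite_rem_rows[OF assms] card_image)
qed

lemma is_partition_add_cell:
  assumes lam: "is_partition lam" and r: "1 \<le> r"
  shows "is_partition (add_cell lam r) \<longleftrightarrow> r \<in> add_rows lam"
proof
  assume k: "is_partition (add_cell lam r)"
  have "lam r < lam (r - 1)" if "r \<noteq> 1"
  proof -
    have "1 \<le> r - 1" "r - 1 \<le> r" "r - 1 \<noteq> r"
      using that r by auto
    then show ?thesis
      using partition_antimono[OF k, of "r - 1" r] by simp
  qed
  then show "r \<in> add_rows lam" using r by (auto simp: add_rows_def)
next
  assume a: "r \<in> add_rows lam"
  have "finite (insert r {s. lam s \<noteq> 0})"
    using lam by (simp add: is_partition_def)
  then have "finite {s. add_cell lam r s \<noteq> 0}"
    by (rule finite_subset[rotated]) auto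
  moreover have "add_cell lam r (Suc s) \<le> add_cell lam r s" if "1 \<le> s" for s
    using lam a that by (auto simp: is_partition_def add_rows_def le_Suc_eq)
  ultimately show "is_partition (add_cell lam r)"
    using lam r by (auto simp: is_partition_def)
qed

lemma is_partition_remove_cell:
  assumes lam: "is_partition lam" and r: "1 \<le> r" and lam_eq: "lam = add_cell \<mu> r"
  shows "is_partition \<mu> \<longleftrightarrow> r \<in> rem_rows lam"
proof
  assume k: "is_partition \<mu>"
  have "\<mu> (Suc r) \<le> \<mu> r"
    using partition_antimono[OF k r, of "Suc r"] by simp
  then show "r \<in> rem_rows lam" using r by (auto simp: rem_rows_def lam_eq)
next
  assume a: "r \<in> rem_rows lam"
  have l: "lam s = (if s = r then Suc (\<mu> r) else \<mu> s)" for s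
    by (simp add: lam_eq)
  have "finite {s. lam s \<noteq> 0}"
    using lam by (simp add: is_partition_def)
  then have "finite {s. \<mu> s \<noteq> 0}"
    by (rule finite_subset[rotated]) (auto simp: l)
  moreover have "\<mu> (Suc s) \<le> \<mu> s" if "1 \<le> s" for s
  proof -
    have "lam (Suc s) \<le> lam s" using lam that by (auto simp: is_partition_def)
    then show ?thesis using a by (auto simp: rem_rows_def l split: if_splits)
  qed
  moreover have "\<mu> 0 = 0"
    using lam r l[of 0] by (auto simp: is_partition_def)
  ultimately show "is_partition \<mu>"
    by (auto simp: is_partition_def)
qed

lemma up_set_eq:
  assumes "is_partition lam"
  shows "up_set lam = add_cell lam ` add_rows lam"
proof -
  have "1 \<le> r" if "r \<in> add_rows lam" for r using that by (simp add: add_rows_def)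
  then show ?thesis
    using assms is_partition_add_cell[OF assms] by (force simp: up_set_def covered_by_iff)
qed

lemma inj_add_cell: "inj_on (add_cell lam) A"
  by (rule inj_onI) (metis fun_upd_apply n_not_Suc_n)

abbreviation remove_cell :: "parts \<Rightarrow> nat \<Rightarrow> parts" where
  "remove_cell lam r \<equiv> lam(r := lam r - 1)"

lemma add_remove_cell: "r \<in> rem_rows lam \<Longrightarrow> add_cell (remove_cell lam r) r = lam"
  by (auto simp: rem_rows_def)

lemma down_set_eq:
  assumes "is_partition lam"
  shows "down_set lam = remove_cell lam ` rem_rows lam"
proof (intro equalityI subsetI)
  fix \<mu> assume "\<mu> \<in> down_set lam"
  then obtain r where r: "1 \<le> r" "lam = add_cell \<mu> r" "is_partition \<mu>"
    by (auto simp: down_set_def covered_by_iff)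
  then have "r \<in> rem_rows lam"
    using is_partition_remove_cell[OF assms r(1,2)] by simp
  moreover have "\<mu> = remove_cell lam r"
    using r by auto
  ultimately show "\<mu> \<in> remove_cell lam ` rem_rows lam" by blast
next
  fix \<mu> assume "\<mu> \<in> remove_cell lam ` rem_rows lam"
  then obtain r where r: "r \<in> rem_rows lam" "\<mu> = remove_cell lam r" by blast
  have e: "lam = add_cell \<mu> r" and r1: "1 \<le> r"
    using add_remove_cell[OF r(1)] r by (auto simp: rem_rows_def)
  have "is_partition \<mu>"
    using is_partition_remove_cell[OF assms r1 e] r by simp
  then show "\<mu> \<in> down_set lam"
    unfolding down_set_def covered_by_iff using e r1 assms by auto
qed

lemma inj_remove_cell: "inj_on (remove_cell lam) (rem_rows lam)"
proof (rule inj_onI)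
  fix r s assume "r \<in> rem_rows lam" and e: "remove_cell lam r = remove_cell lam s"
  then have "lam r - 1 \<noteq> lam r" by (auto simp: rem_rows_def)
  then show "r = s" using fun_cong[OF e, of r] by (auto split: if_splits)
qed

section \<open>Products along the boundary of the diagram\<close>

lemma col_height_Suc_le:
  assumes "is_partition lam" "1 \<le> c"
  shows "col_height lam (Suc c) \<le> col_height lam c"
proof (cases "col_height lam (Suc c) = 0")
  case False
  then show ?thesis
    using le_part_iff_le_col_height[OF assms(1), of "col_height lam (Suc c)" "Suc c"]
      le_part_iff_le_col_height[OF assms(1), of "col_height lam (Suc c)" c] assms(2) by simp
qed simp

lemma col_height_rem_row:
  assumes lam: "is_partition lam" and r: "r \<in> rem_rows lam"
  shows "col_height lam (lam r) = r"
proof -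
  have r1: "1 \<le> r" "1 \<le> lam r" "lam (Suc r) < lam r"
    using r by (auto simp: rem_rows_def)
  then show ?thesis
    using le_part_iff_le_col_height[OF lam r1(1,2)] le_part_iff_le_col_height[OF lam _ r1(2), of "Suc r"]
    by simp
qed

lemma Suc_col_height_add_row:
  assumes lam: "is_partition lam" and r: "r \<in> add_rows lam"
  shows "Suc (col_height lam (Suc (lam r))) = r"
proof -
  have r1: "1 \<le> r" "r = 1 \<or> Suc (lam r) \<le> lam (r - 1)"
    using r by (auto simp: add_rows_def)
  have lt: "col_height lam (Suc (lam r)) < r"
    using le_part_iff_le_col_height[OF lam r1(1), of "Suc (lam r)"] by simp
  have "r - 1 \<le> col_height lam (Suc (lam r))"
    using le_part_iff_le_col_height[OF lam, of "r - 1" "Suc (lam r)"] r1 by (cases "r = 1") auto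
  then show ?thesis using lt by simp
qed

text \<open>A removable cell ends both its row and its column, so it is found by scanning the rows or the columns.\<close>

lemma rem_rows_col_height:
  assumes lam: "is_partition lam"
  shows "rem_rows (col_height lam) = lam ` rem_rows lam"
proof (intro equalityI subsetI)
  fix c assume "c \<in> rem_rows (col_height lam)"
  then have c: "1 \<le> c" "col_height lam (Suc c) < col_height lam c"
    by (auto simp: rem_rows_def)
  define r where "r = col_height lam c"
  have r1: "1 \<le> r" using c by (simp add: r_def)
  have "c \<le> lam r" "\<not> Suc c \<le> lam r" "\<not> c \<le> lam (Suc r)"
    using le_part_iff_le_col_height[OF lam r1 c(1)] le_part_iff_le_col_height[OF lam r1, of "Suc c"]
      le_part_iff_le_col_height[OF lam _ c(1), of "Suc r"] c(2) by (simp_all add: r_def)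
  then have "c = lam r" "r \<in> rem_rows lam"
    using r1 by (simp_all add: rem_rows_def)
  then show "c \<in> lam ` rem_rows lam" by blast
next
  fix c assume "c \<in> lam ` rem_rows lam"
  then obtain r where r: "r \<in> rem_rows lam" and c: "c = lam r" by blast
  have r1: "1 \<le> r" "1 \<le> c" using r by (auto simp: rem_rows_def c)
  have "\<not> r \<le> col_height lam (Suc c)"
    using le_part_iff_le_col_height[OF lam r1(1), of "Suc c"] by (simp add: c)
  then show "c \<in> rem_rows (col_height lam)"
    using col_height_rem_row[OF lam r] r1 by (simp add: rem_rows_def c)
qed

text \<open>The analogous statement for addable cells, each of which is the first empty cell of its row and of
its column.\<close>

lemma add_rows_col_height:
  assumes lam: "is_partition lam"
  shows "add_rows (col_height lam) = (\<lambda>r. Suc (lam r)) ` add_rows lam"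
proof (intro equalityI subsetI)
  fix c assume "c \<in> add_rows (col_height lam)"
  then have c: "1 \<le> c" "c = 1 \<or> col_height lam c < col_height lam (c - 1)"
    by (auto simp: add_rows_def)
  define r where "r = Suc (col_height lam c)"
  have "\<not> c \<le> lam r"
    using le_part_iff_le_col_height[OF lam _ c(1), of r] by (simp add: r_def)
  moreover have "c - 1 \<le> lam r"
    using le_part_iff_le_col_height[OF lam, of r "c - 1"] c by (cases "c = 1") (auto simp: r_def)
  ultimately have cr: "c = Suc (lam r)" using c by simp
  have "c \<le> lam (r - 1)" if "r \<noteq> 1"
    using le_part_iff_le_col_height[OF lam _ c(1), of "r - 1"] that by (simp add: r_def)
  moreover have "1 \<le> r" by (simp add: r_def)
  ultimately have "r \<in> add_rows lam"
    using cr by (cases "r = 1") (auto simp: add_rows_def)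
  then show "c \<in> (\<lambda>r. Suc (lam r)) ` add_rows lam" using cr by blast
next
  fix c assume "c \<in> (\<lambda>r. Suc (lam r)) ` add_rows lam"
  then obtain r where r: "r \<in> add_rows lam" and c: "c = Suc (lam r)" by blast
  have r1: "1 \<le> r" using r by (simp add: add_rows_def)
  have "r \<le> col_height lam (lam r)" if "lam r \<noteq> 0"
    using le_part_iff_le_col_height[OF lam r1, of "lam r"] that by simp
  then show "c \<in> add_rows (col_height lam)"
    using Suc_col_height_add_row[OF lam r] by (cases "lam r = 0") (auto simp: add_rows_def c)
qed

text \<open>The point of the first empty cell of row \<open>r\<close>, and the point of the cell directly above that one.
If row \<open>r\<close> ends in a removable cell, \<open>outer_pt lam r\<close> belongs to the diagonal neighbour of this cell.
In the interpolation identities the inner points of addable rows are the nodes \<open>y\<close> and the outer points of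
removable rows are the \<open>z\<close>.\<close>

definition inner_pt :: "parts \<Rightarrow> nat \<Rightarrow> ratfun" where
  "inner_pt lam r = monom_pt (Suc (lam r)) r"

definition outer_pt :: "parts \<Rightarrow> nat \<Rightarrow> ratfun" where
  "outer_pt lam r = monom_pt (Suc (lam r)) (Suc r)"

text \<open>The product over the columns to the left of column \<open>c0\<close> and the rows below row \<open>r0\<close> that the four
quantities \<open>\<alpha>\<close>, barred or not, for addition or removal of a cell \<open>(r0, c0)\<close>, have in common up to a
power of \<open>t\<close>: the barred and the unbarred version differ only in the point \<open>p\<close> of evaluation.\<close>

definition boundary_prod :: "parts \<Rightarrow> nat \<Rightarrow> nat \<Rightarrow> ratfun \<Rightarrow> ratfun" where
  "boundary_prod lam r0 c0 p =
     (\<Prod>c\<in>{1..<c0}. (p - monom_pt (Suc c) (Suc (col_height lam c)))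
                     / (p - monom_pt c (Suc (col_height lam c)))) *
     (\<Prod>r\<in>{1..<r0}. (p - outer_pt lam r) / (p - inner_pt lam r))"

lemma inj_on_rem_rows: "is_partition lam \<Longrightarrow> inj_on lam (rem_rows lam)"
  by (rule inj_on_inverseI) (rule col_height_rem_row)

lemma inj_on_add_rows: "is_partition lam \<Longrightarrow> inj_on (\<lambda>r. Suc (lam r)) (add_rows lam)"
  by (rule inj_on_inverseI[of _ "\<lambda>c. Suc (col_height lam c)"]) (rule Suc_col_height_add_row)

text \<open>Consecutive columns of equal height, and consecutive rows of equal length, cancel. The condition on \<open>p\<close>
keeps all denominators nonzero: the points in them lie strictly to the left of \<open>p\<close> or strictly
below it.\<close>

lemma boundary_prod_telescoped:
  assumes lam: "is_partition lam" and rc: "1 \<le> r0" "1 \<le> c0"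
    and p: "p = monom_pt c r" "c0 \<le> c" "r0 \<le> r"
  shows "boundary_prod lam r0 c0 p =
      ((\<Prod>b\<in>{b \<in> rem_rows lam. lam b < c0}. p - outer_pt lam b)
        / (\<Prod>a\<in>{a \<in> add_rows lam. Suc (lam a) < c0}. p - inner_pt lam a)
        * (if c0 \<in> add_rows (col_height lam) then 1 else p - monom_pt c0 (Suc (col_height lam c0)))) *
      ((\<Prod>b\<in>{b \<in> rem_rows lam. b < r0}. p - outer_pt lam b)
        / (\<Prod>a\<in>{a \<in> add_rows lam. a < r0}. p - inner_pt lam a)
        * (if r0 \<in> add_rows lam then 1 else p - inner_pt lam r0))"
proof -
  let ?h = "col_height lam"
  have step: "Suc k \<in> add_rows f \<longleftrightarrow> k \<in> rem_rows f" if "1 \<le> k" for f k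
    using that by (auto simp: add_rows_def rem_rows_def)
  have one: "1 \<in> add_rows f" for f by (simp add: add_rows_def)
  have cols: "(\<Prod>k\<in>{1..<c0}. (p - monom_pt (Suc k) (Suc (?h k))) / (p - monom_pt k (Suc (?h k))))
    = (\<Prod>k\<in>{k\<in>{1..<c0}. Suc k \<in> add_rows ?h}. p - monom_pt (Suc k) (Suc (?h k)))
      / (\<Prod>k\<in>{k\<in>{1..<c0}. k \<in> add_rows ?h}. p - monom_pt k (Suc (?h k)))
      * (if c0 \<in> add_rows ?h then 1 else p - monom_pt c0 (Suc (?h c0)))"
  proof (rule prod_ratio_telescope[where Q = "\<lambda>k. k \<in> add_rows ?h", OF rc(2) one])
    fix k assume k: "1 \<le> k" "k < c0"
    show "p - monom_pt k (Suc (?h k)) \<noteq> 0"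
      using k p by simp
    assume "Suc k \<notin> add_rows ?h"
    then have "?h (Suc k) = ?h k"
      using col_height_Suc_le[OF lam k(1)] k by (simp add: add_rows_def)
    then show "p - monom_pt (Suc k) (Suc (?h k)) = p - monom_pt (Suc k) (Suc (?h (Suc k)))"
      by simp
  qed
  have rows: "(\<Prod>k\<in>{1..<r0}. (p - outer_pt lam k) / (p - inner_pt lam k))
    = (\<Prod>k\<in>{k\<in>{1..<r0}. Suc k \<in> add_rows lam}. p - outer_pt lam k)
      / (\<Prod>k\<in>{k\<in>{1..<r0}. k \<in> add_rows lam}. p - inner_pt lam k)
      * (if r0 \<in> add_rows lam then 1 else p - inner_pt lam r0)"
  proof (rule prod_ratio_telescope[where Q = "\<lambda>k. k \<in> add_rows lam", OF rc(1) one])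
    fix k assume k: "1 \<le> k" "k < r0"
    show "p - inner_pt lam k \<noteq> 0"
      using k p by (simp add: inner_pt_def)
    assume "Suc k \<notin> add_rows lam"
    then have "lam (Suc k) = lam k"
      using partition_antimono[OF lam k(1), of "Suc k"] by (simp add: add_rows_def)
    then show "p - outer_pt lam k = p - inner_pt lam (Suc k)"
      by (simp add: outer_pt_def inner_pt_def)
  qed
  have 1: "{k\<in>{1..<c0}. Suc k \<in> add_rows ?h} = lam ` {b \<in> rem_rows lam. lam b < c0}"
  proof -
    have "{k\<in>{1..<c0}. Suc k \<in> add_rows ?h} = {k \<in> rem_rows ?h. k < c0}"
      using step[of _ ?h] by (auto simp: rem_rows_def)
    then show ?thesis unfolding rem_rows_col_height[OF lam] by auto
  qed
  have 2: "{k\<in>{1..<c0}. k \<in> add_rows ?h} = (\<lambda>r. Suc (lam r)) ` {a \<in> add_rows lam. Suc (lam a) < c0}"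
    unfolding add_rows_col_height[OF lam] by auto
  have 3: "{k\<in>{1..<r0}. Suc k \<in> add_rows lam} = {b \<in> rem_rows lam. b < r0}"
    using step[of _ lam] by (auto simp: rem_rows_def)
  have 4: "{k\<in>{1..<r0}. k \<in> add_rows lam} = {a \<in> add_rows lam. a < r0}"
    by (auto simp: add_rows_def)
  have "(\<Prod>k\<in>{k\<in>{1..<c0}. Suc k \<in> add_rows ?h}. p - monom_pt (Suc k) (Suc (?h k)))
      = (\<Prod>b\<in>{b \<in> rem_rows lam. lam b < c0}. p - outer_pt lam b)"
    unfolding 1 using inj_on_rem_rows[OF lam]
    by (subst prod.reindex) (auto intro: inj_on_subset prod.cong simp: col_height_rem_row[OF lam] outer_pt_def)
  moreover have "(\<Prod>k\<in>{k\<in>{1..<c0}. k \<in> add_rows ?h}. p - monom_pt k (Suc (?h k)))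
      = (\<Prod>a\<in>{a \<in> add_rows lam. Suc (lam a) < c0}. p - inner_pt lam a)"
    unfolding 2
    by (subst prod.reindex[OF inj_on_subset[OF inj_on_add_rows[OF lam]]])
      (auto intro: prod.cong simp: Suc_col_height_add_row[OF lam] inner_pt_def)
  ultimately show ?thesis
    unfolding boundary_prod_def cols rows 3 4 by simp
qed

text \<open>Seen from an addable cell, each other corner is either above and to the left or below and to the
right, so the column product and the row product together contain each of them exactly once.\<close>

lemma boundary_prod_addable:
  assumes lam: "is_partition lam" and r0: "r0 \<in> add_rows lam"
    and p: "p = monom_pt c r" "Suc (lam r0) \<le> c" "r0 \<le> r"
  shows "boundary_prod lam r0 (Suc (lam r0)) p =
    (\<Prod>b\<in>rem_rows lam. p - outer_pt lam b) / (\<Prod>a\<in>add_rows lam - {r0}. p - inner_pt lam a)"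
proof -
  let ?A = "add_rows lam" and ?B = "rem_rows lam" and ?c0 = "Suc (lam r0)"
  have r1: "1 \<le> r0" and r0': "r0 = 1 \<or> lam r0 < lam (r0 - 1)" using r0 by (auto simp: add_rows_def)
  have c0: "?c0 \<in> add_rows (col_height lam)"
    using r0 by (simp add: add_rows_col_height[OF lam])
  have anti: "lam j \<le> lam i" if "1 \<le> i" "i \<le> j" for i j
    using partition_antimono[OF lam that] .
  have B: "lam b < ?c0 \<longleftrightarrow> \<not> b < r0" if b: "b \<in> ?B" for b
  proof
    assume "lam b < ?c0"
    then show "\<not> b < r0"
      using b anti[of "Suc b" r0] by (auto simp: rem_rows_def)
  next
    assume "\<not> b < r0"
    then show "lam b < ?c0" using anti[OF r1, of b] by simp
  qed
  have A: "Suc (lam a) < ?c0 \<longleftrightarrow> \<not> a < r0" if a: "a \<in> ?A - {r0}" for a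
  proof
    assume "Suc (lam a) < ?c0"
    then show "\<not> a < r0"
      using a anti[of a r0] by (auto simp: add_rows_def)
  next
    assume "\<not> a < r0"
    then have "r0 \<le> a - 1" "lam a < lam (a - 1)"
      using a r1 by (auto simp: add_rows_def)
    then show "Suc (lam a) < ?c0"
      using anti[OF r1, of "a - 1"] by simp
  qed
  have Bs: "?B = {b \<in> ?B. lam b < ?c0} \<union> {b \<in> ?B. b < r0}"
      "{b \<in> ?B. lam b < ?c0} \<inter> {b \<in> ?B. b < r0} = {}"
    using B by blast+
  have As: "?A - {r0} = {a \<in> ?A. Suc (lam a) < ?c0} \<union> {a \<in> ?A. a < r0}"
      "{a \<in> ?A. Suc (lam a) < ?c0} \<inter> {a \<in> ?A. a < r0} = {}"
    using A by blast+
  have "(\<Prod>b\<in>?B. p - outer_pt lam b)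
    = (\<Prod>b\<in>{b \<in> ?B. lam b < ?c0}. p - outer_pt lam b) * (\<Prod>b\<in>{b \<in> ?B. b < r0}. p - outer_pt lam b)"
    by (subst Bs(1), rule prod.union_disjoint) (use Bs(2) finite_rem_rows[OF lam] in auto)
  moreover have "(\<Prod>a\<in>?A - {r0}. p - inner_pt lam a)
    = (\<Prod>a\<in>{a \<in> ?A. Suc (lam a) < ?c0}. p - inner_pt lam a) * (\<Prod>a\<in>{a \<in> ?A. a < r0}. p - inner_pt lam a)"
    by (subst As(1), rule prod.union_disjoint) (use As(2) finite_add_rows[OF lam] in auto)
  ultimately show ?thesis
    using boundary_prod_telescoped[OF lam r1 _ p(1,2,3)] c0 r0 by simp
qed

text \<open>At a removable cell both telescoping products may stop inside a block. The leftover numerators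
\<open>p - inner_pt lam r0\<close> and \<open>p - monom_pt (lam r0) (Suc r0)\<close> are also the denominators that the addable cells
of row \<open>r0\<close> and of column \<open>lam r0\<close> contribute if these cells exist. So these two factors appear
in every case, once the second product runs over all addable cells.\<close>

lemma boundary_prod_removable:
  assumes lam: "is_partition lam" and r0: "r0 \<in> rem_rows lam"
    and p: "p = monom_pt c r" "lam r0 \<le> c" "r0 \<le> r"
    and ne: "p \<noteq> inner_pt lam r0" "p \<noteq> monom_pt (lam r0) (Suc r0)"
  shows "boundary_prod lam r0 (lam r0) p =
    (p - inner_pt lam r0) * (p - monom_pt (lam r0) (Suc r0)) *
    ((\<Prod>b\<in>rem_rows lam - {r0}. p - outer_pt lam b) / (\<Prod>a\<in>add_rows lam. p - inner_pt lam a))"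
proof -
  let ?A = "add_rows lam" and ?B = "rem_rows lam" and ?c0 = "lam r0" and ?f = "\<lambda>a. p - inner_pt lam a"
  have r1: "1 \<le> r0" "1 \<le> ?c0" and r0': "lam (Suc r0) < ?c0" using r0 by (auto simp: rem_rows_def)
  have anti: "lam j \<le> lam i" if "1 \<le> i" "i \<le> j" for i j
    using partition_antimono[OF lam that] .
  have h: "col_height lam ?c0 = r0" by (rule col_height_rem_row[OF lam r0])
  have sA: "Suc r0 \<in> ?A" using r0 by (simp add: add_rows_eq)
  have c0: "?c0 \<in> add_rows (col_height lam) \<longleftrightarrow> Suc (lam (Suc r0)) = ?c0"
  proof
    assume "?c0 \<in> add_rows (col_height lam)"
    then obtain a where a: "a \<in> ?A" "?c0 = Suc (lam a)"
      unfolding add_rows_col_height[OF lam] by blast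
    then have "a = Suc r0"
      using Suc_col_height_add_row[OF lam a(1)] h by simp
    then show "Suc (lam (Suc r0)) = ?c0" using a by simp
  next
    assume "Suc (lam (Suc r0)) = ?c0"
    then show "?c0 \<in> add_rows (col_height lam)"
      using sA unfolding add_rows_col_height[OF lam] by force
  qed
  have B: "lam b < ?c0 \<longleftrightarrow> \<not> b < r0" if b: "b \<in> ?B - {r0}" for b
  proof
    assume "lam b < ?c0"
    then show "\<not> b < r0" using b anti[of b r0] by (auto simp: rem_rows_def)
  next
    assume "\<not> b < r0"
    then have "Suc r0 \<le> b" using b by auto
    then show "lam b < ?c0" using anti[of "Suc r0" b] r0' by simp
  qed
  \<comment> \<open>The addable cells split into those to the left (\<open>X\<close>), those below (\<open>Y\<close>), and those in the row or column of the removed cell (\<open>Z\<close>).\<close>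
  define X where "X = {a \<in> ?A. Suc (lam a) < ?c0}"
  define Y where "Y = {a \<in> ?A. a < r0}"
  define Z where "Z = {a \<in> ?A. a = r0 \<or> a = Suc r0 \<and> Suc (lam a) = ?c0}"
  have XY: "X \<inter> Y = {}"
    using anti[of _ r0] by (force simp: X_def Y_def add_rows_def)
  have XYZ: "(X \<union> Y) \<inter> Z = {}"
    by (auto simp: X_def Y_def Z_def)
  have "a \<in> X \<union> Y \<union> Z" if a: "a \<in> ?A" for a
  proof -
    consider "a < r0" | "a = r0" | "a = Suc r0" | "Suc r0 \<le> a - 1" by linarith
    then show ?thesis
    proof cases
      case 3
      then show ?thesis using a r0' by (auto simp: X_def Z_def)
    next
      case 4
      then have "lam a < lam (a - 1)" "lam (a - 1) \<le> lam (Suc r0)"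
        using a anti[of "Suc r0" "a - 1"] by (auto simp: add_rows_def)
      then show ?thesis using a r0' by (auto simp: X_def)
    qed (use a in \<open>auto simp: Y_def Z_def\<close>)
  qed
  then have A: "?A = X \<union> Y \<union> Z"
    by (auto simp: X_def Y_def Z_def)
  have fin: "finite X" "finite Y" "finite Z"
    using finite_add_rows[OF lam] by (auto simp: X_def Y_def Z_def)
  have pA: "prod ?f ?A = prod ?f X * prod ?f Y * prod ?f Z"
    unfolding A using fin XY XYZ by (simp add: prod.union_disjoint)
  have Z_eq: "Z = (if r0 \<in> ?A then {r0} else {}) \<union> (if Suc (lam (Suc r0)) = ?c0 then {Suc r0} else {})"
    using sA by (auto simp: Z_def)
  have pZ: "prod ?f Z = (if r0 \<in> ?A then p - inner_pt lam r0 else 1)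
      * (if Suc (lam (Suc r0)) = ?c0 then p - monom_pt ?c0 (Suc r0) else 1)"
    unfolding Z_eq by (auto simp: inner_pt_def)
  have Bs: "?B - {r0} = {b \<in> ?B. lam b < ?c0} \<union> {b \<in> ?B. b < r0}"
      "{b \<in> ?B. lam b < ?c0} \<inter> {b \<in> ?B. b < r0} = {}"
    using B by blast+
  have pB: "(\<Prod>b\<in>?B - {r0}. p - outer_pt lam b)
    = (\<Prod>b\<in>{b \<in> ?B. lam b < ?c0}. p - outer_pt lam b) * (\<Prod>b\<in>{b \<in> ?B. b < r0}. p - outer_pt lam b)"
    by (subst Bs(1), rule prod.union_disjoint) (use Bs(2) finite_rem_rows[OF lam] in auto)
  show ?thesis
    unfolding boundary_prod_telescoped[OF lam r1 p] pA pB pZ c0 h X_def[symmetric] Y_def[symmetric]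
    using ne by (simp add: divide_simps)
qed

section \<open>Evaluating the hook products\<close>

lemma one_minus_ratio:
  fixes p a b :: "'a::field"
  assumes "p \<noteq> 0"
  shows "(1 - a / p) / (1 - b / p) = (p - a) / (p - b)"
proof -
  have "1 - a / p = (p - a) / p" "1 - b / p = (p - b) / p"
    using assms by (simp_all add: diff_divide_distrib)
  then show ?thesis using assms by simp
qed

text \<open>An outer point is \<open>t\<close> times the inner point of its row. This one factor of \<open>t\<close> for each row below
row \<open>r0\<close> accounts for the power \<open>t ^ (r0 - 1)\<close> in the transition probabilities.\<close>

lemma t_times_one_minus_ratio:
  "var_t * ((1 - p / outer_pt lam r) / (1 - p / inner_pt lam r)) = (p - outer_pt lam r) / (p - inner_pt lam r)"
proof -
  let ?y = "inner_pt lam r"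
  have y: "?y \<noteq> 0" by (simp add: inner_pt_def)
  have o: "outer_pt lam r = var_t * ?y"
    by (simp add: outer_pt_def inner_pt_def monom_pt_def)
  have "1 - p / (var_t * ?y) = (p - var_t * ?y) / (- (var_t * ?y))"
    "1 - p / ?y = (p - ?y) / (- ?y)"
    using y by (simp_all add: diff_divide_distrib)
  then show ?thesis
    unfolding o using y by simp
qed

text \<open>Only hooks in the row and the column of the new cell \<open>(r0, c0)\<close> change. In this row the leg lengths, and in
this column the arm lengths, agree in \<open>\<rho>\<close> and \<open>\<kappa>\<close>, and they are measured by columns other than
\<open>c0\<close> and rows other than \<open>r0\<close>; hence either partition may serve to describe the boundary. Taking \<open>\<rho>\<close>
suits the addition of a cell to a fixed partition, and \<open>\<kappa>\<close> its removal. Exchanging the two kinds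
of hooks moves the evaluation point one step along the diagonal.\<close>

lemma alpha_eq_boundary_prod:
  assumes part: "is_partition \<rho>" "is_partition \<kappa>" and r0: "1 \<le> r0"
    and \<kappa>: "\<kappa> = add_cell \<rho> r0" and c0: "c0 = Suc (\<rho> r0)" and lam: "lam = \<rho> \<or> lam = \<kappa>"
  shows "var_t ^ (r0 - 1) * alpha \<kappa> \<rho> = boundary_prod lam r0 c0 (monom_pt c0 r0)"
    and "var_t ^ (r0 - 1) * alpha_bar \<kappa> \<rho> = boundary_prod lam r0 c0 (monom_pt (Suc c0) (Suc r0))"
proof -
  have row: "\<rho> r = lam r" "\<kappa> r = lam r" if "r \<noteq> r0" for r
    using that \<kappa> lam by auto
  have "{r. 1 \<le> r \<and> c \<le> \<rho> r} = {r. 1 \<le> r \<and> c \<le> \<kappa> r}" if "c \<noteq> c0" for c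
    using that by (auto simp: \<kappa> c0)
  then have col: "col_height \<rho> c = col_height lam c" "col_height \<kappa> c = col_height lam c" if "c \<noteq> c0" for c
    using that lam by (auto simp: col_height_def)
  have c1: "1 \<le> c0" by (simp add: c0)
  have \<kappa>r0: "\<kappa> r0 = c0" by (simp add: \<kappa> c0)
  have lower: "c0 \<le> lam r" if "1 \<le> r" "r < r0" for r
    using partition_antimono[OF part(2), of r r0] that row[of r] by (simp add: \<kappa>r0)
  have upper: "lam r < c0" if "r0 < r" for r
    using partition_antimono[OF part(1), of r0 r] that r0 row[of r] by (simp add: c0)
  have tall: "r0 \<le> col_height lam c" if "1 \<le> c" "c < c0" for c
    using le_part_iff_le_col_height[OF part(1) r0, of c] that col[of c] by (simp add: c0)
  have hk: "col_height \<kappa> c0 = r0"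
    using le_part_iff_le_col_height[OF part(2) r0 c1] le_part_iff_le_col_height[OF part(2) _ c1, of "Suc r0"]
      upper[of "Suc r0"] row[of "Suc r0"] by (simp add: \<kappa>r0)
  have "r0 - 1 \<le> col_height \<rho> c0"
  proof (cases "r0 = 1")
    case False
    then have "1 \<le> r0 - 1" "r0 - 1 < r0" using r0 by auto
    then show ?thesis
      using le_part_iff_le_col_height[OF part(1) _ c1, of "r0 - 1"] lower[of "r0 - 1"] row[of "r0 - 1"] by simp
  qed simp
  moreover have "col_height \<rho> c0 < r0"
    using le_part_iff_le_col_height[OF part(1) r0 c1] by (simp add: c0)
  ultimately have hr: "col_height \<rho> c0 = r0 - 1" by simp
  have diff: "diagram \<kappa> - diagram \<rho> = {(r0, c0)}"
    unfolding \<kappa> c0 by (rule diagram_add_cell(1)[OF r0])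
  have rows: "row_cells \<kappa> \<rho> = Pair r0 ` {1..<c0}"
    using r0 unfolding row_cells_def diff by (auto simp: diagram_iff c0)
  have cols: "col_cells \<kappa> \<rho> = (\<lambda>r. (r, c0)) ` {1..<r0}"
  proof -
    have rows_above: "1 \<le> r \<and> c0 \<le> \<rho> r \<longleftrightarrow> r \<in> {1..<r0}" for r
    proof (cases r r0 rule: linorder_cases)
      case less
      then show ?thesis using lower[of r] row(1)[of r] by auto
    next
      case equal
      then show ?thesis by (simp add: c0)
    next
      case greater
      then show ?thesis using upper[of r] row(1)[of r] by simp
    qed
    have "col_cells \<kappa> \<rho> = (\<lambda>r. (r, c0)) ` {r. 1 \<le> r \<and> c0 \<le> \<rho> r}"
      using c1 unfolding col_cells_def diff by (auto simp: diagram_iff)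
    then show ?thesis
      unfolding rows_above by (simp only: Collect_mem_eq)
  qed
  let ?y = "\<lambda>c. monom_pt c (Suc (col_height lam c))" and ?z = "\<lambda>c. monom_pt (Suc c) (Suc (col_height lam c))"
  have row_leg: "hook_leg \<rho> (r0, c) / hook_leg \<kappa> (r0, c) = (monom_pt c0 r0 - ?z c) / (monom_pt c0 r0 - ?y c)"
    and row_arm: "hook_arm \<rho> (r0, c) / hook_arm \<kappa> (r0, c)
       = (monom_pt (Suc c0) (Suc r0) - ?z c) / (monom_pt (Suc c0) (Suc r0) - ?y c)"
    if c: "c \<in> {1..<c0}" for c
  proof -
    have c': "1 \<le> c" "c < c0" "r0 \<le> col_height lam c" using c tall[of c] by simp_all
    have legs: "leg \<rho> (r0, c) = col_height lam c - r0" "leg \<kappa> (r0, c) = col_height lam c - r0"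
      using c' col[of c] part by (simp_all add: leg_eq)
    have arms: "arm \<rho> (r0, c) = c0 - Suc c" "arm \<kappa> (r0, c) = c0 - c"
      using r0 by (simp_all add: arm_eq \<kappa>r0) (simp add: c0)
    have "hook_leg \<rho> (r0, c) = 1 - ?z c / monom_pt c0 r0" "hook_leg \<kappa> (r0, c) = 1 - ?y c / monom_pt c0 r0"
      using monom_pt_ratio[of "Suc c" c0 r0 "Suc (col_height lam c)"]
        monom_pt_ratio[of c c0 r0 "Suc (col_height lam c)"] c'
      by (simp_all add: hook_leg_def legs arms Suc_diff_le)
    then show "hook_leg \<rho> (r0, c) / hook_leg \<kappa> (r0, c) = (monom_pt c0 r0 - ?z c) / (monom_pt c0 r0 - ?y c)"
      by (simp add: one_minus_ratio)
    have e: "c0 - Suc c + 1 = Suc c0 - Suc c" "c0 - c + 1 = Suc c0 - c"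
      using c' by auto
    have "hook_arm \<rho> (r0, c) = 1 - ?z c / monom_pt (Suc c0) (Suc r0)"
      "hook_arm \<kappa> (r0, c) = 1 - ?y c / monom_pt (Suc c0) (Suc r0)"
      using monom_pt_ratio[of "Suc c" "Suc c0" "Suc r0" "Suc (col_height lam c)"]
        monom_pt_ratio[of c "Suc c0" "Suc r0" "Suc (col_height lam c)"] c'
      unfolding hook_arm_def legs arms e by simp_all
    then show "hook_arm \<rho> (r0, c) / hook_arm \<kappa> (r0, c)
       = (monom_pt (Suc c0) (Suc r0) - ?z c) / (monom_pt (Suc c0) (Suc r0) - ?y c)"
      by (simp add: one_minus_ratio)
  qed
  have col_arm: "var_t * (hook_arm \<rho> (r, c0) / hook_arm \<kappa> (r, c0))
      = (monom_pt c0 r0 - outer_pt lam r) / (monom_pt c0 r0 - inner_pt lam r)"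
    and col_leg: "var_t * (hook_leg \<rho> (r, c0) / hook_leg \<kappa> (r, c0))
      = (monom_pt (Suc c0) (Suc r0) - outer_pt lam r) / (monom_pt (Suc c0) (Suc r0) - inner_pt lam r)"
    if r: "r \<in> {1..<r0}" for r
  proof -
    have r': "1 \<le> r" "r < r0" "c0 \<le> lam r" using r lower[of r] by simp_all
    have legs: "leg \<rho> (r, c0) = r0 - Suc r" "leg \<kappa> (r, c0) = r0 - r"
      using part c1 by (simp_all add: leg_eq hr hk)
    have arms: "arm \<rho> (r, c0) = lam r - c0" "arm \<kappa> (r, c0) = lam r - c0"
      using r' row[of r] by (simp_all add: arm_eq)
    have "hook_arm \<rho> (r, c0) = 1 - monom_pt c0 r0 / outer_pt lam r"
      "hook_arm \<kappa> (r, c0) = 1 - monom_pt c0 r0 / inner_pt lam r"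
      using monom_pt_ratio[of c0 "Suc (lam r)" "Suc r" r0] monom_pt_ratio[of c0 "Suc (lam r)" r r0] r'
      by (simp_all add: hook_arm_def legs arms outer_pt_def inner_pt_def Suc_diff_le)
    then show "var_t * (hook_arm \<rho> (r, c0) / hook_arm \<kappa> (r, c0))
      = (monom_pt c0 r0 - outer_pt lam r) / (monom_pt c0 r0 - inner_pt lam r)"
      by (simp only: t_times_one_minus_ratio)
    have e: "r0 - Suc r + 1 = Suc r0 - Suc r" "r0 - r + 1 = Suc r0 - r"
      using r' by auto
    have "hook_leg \<rho> (r, c0) = 1 - monom_pt (Suc c0) (Suc r0) / outer_pt lam r"
      "hook_leg \<kappa> (r, c0) = 1 - monom_pt (Suc c0) (Suc r0) / inner_pt lam r"
      using monom_pt_ratio[of "Suc c0" "Suc (lam r)" "Suc r" "Suc r0"]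
        monom_pt_ratio[of "Suc c0" "Suc (lam r)" r "Suc r0"] r'
      unfolding hook_leg_def legs arms e outer_pt_def inner_pt_def by simp_all
    then show "var_t * (hook_leg \<rho> (r, c0) / hook_leg \<kappa> (r, c0))
      = (monom_pt (Suc c0) (Suc r0) - outer_pt lam r) / (monom_pt (Suc c0) (Suc r0) - inner_pt lam r)"
      by (simp only: t_times_one_minus_ratio)
  qed
  have t_prod: "var_t ^ (r0 - 1) * (\<Prod>x\<in>col_cells \<kappa> \<rho>. f x) = (\<Prod>r\<in>{1..<r0}. var_t * f (r, c0))" for f
    by (simp add: cols prod.reindex inj_on_def prod.distrib)
  have r_prod: "(\<Prod>x\<in>row_cells \<kappa> \<rho>. f x) = (\<Prod>c\<in>{1..<c0}. f (r0, c))" for f :: "cell \<Rightarrow> ratfun"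
    by (simp add: rows prod.reindex inj_on_def)
  show "var_t ^ (r0 - 1) * alpha \<kappa> \<rho> = boundary_prod lam r0 c0 (monom_pt c0 r0)"
    unfolding alpha_def mult.left_commute[of "var_t ^ _"] t_prod r_prod boundary_prod_def
    using row_leg col_arm by (intro arg_cong2[where f = "(*)"] prod.cong) simp_all
  show "var_t ^ (r0 - 1) * alpha_bar \<kappa> \<rho> = boundary_prod lam r0 c0 (monom_pt (Suc c0) (Suc r0))"
    unfolding alpha_bar_def mult.left_commute[of "var_t ^ _"] t_prod r_prod boundary_prod_def
    using row_arm col_leg by (intro arg_cong2[where f = "(*)"] prod.cong) simp_all
qed

text \<open>The evaluation points that are not already inner or outer points: for the barred product of an
addable cell the diagonal neighbour of the cell, and for the unbarred product of a removable cell the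
cell itself.\<close>

definition up_point :: "parts \<Rightarrow> nat \<Rightarrow> ratfun" where
  "up_point lam r = monom_pt (Suc (Suc (lam r))) (Suc r)"

definition down_point :: "parts \<Rightarrow> nat \<Rightarrow> ratfun" where
  "down_point lam m = monom_pt (lam m) m"

lemma up_alpha:
  assumes lam: "is_partition lam" and r: "r \<in> add_rows lam"
  shows "var_t ^ (r - 1) * alpha (add_cell lam r) lam
      = (\<Prod>b\<in>rem_rows lam. inner_pt lam r - outer_pt lam b)
        / (\<Prod>a\<in>add_rows lam - {r}. inner_pt lam r - inner_pt lam a)"
    and "var_t ^ (r - 1) * alpha_bar (add_cell lam r) lam
      = (\<Prod>b\<in>rem_rows lam. up_point lam r - outer_pt lam b)
        / (\<Prod>a\<in>add_rows lam - {r}. up_point lam r - inner_pt lam a)"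
proof -
  have r1: "1 \<le> r" using r by (simp add: add_rows_def)
  have k: "is_partition (add_cell lam r)"
    using is_partition_add_cell[OF lam r1] r by simp
  note A = alpha_eq_boundary_prod[OF lam k r1 refl refl disjI1[OF refl]]
  show "var_t ^ (r - 1) * alpha (add_cell lam r) lam
      = (\<Prod>b\<in>rem_rows lam. inner_pt lam r - outer_pt lam b)
        / (\<Prod>a\<in>add_rows lam - {r}. inner_pt lam r - inner_pt lam a)"
    unfolding A(1) inner_pt_def[of lam r] by (rule boundary_prod_addable[OF lam r refl]) simp_all
  show "var_t ^ (r - 1) * alpha_bar (add_cell lam r) lam
      = (\<Prod>b\<in>rem_rows lam. up_point lam r - outer_pt lam b)
        / (\<Prod>a\<in>add_rows lam - {r}. up_point lam r - inner_pt lam a)"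
    unfolding A(2) up_point_def by (rule boundary_prod_addable[OF lam r refl]) simp_all
qed

lemma down_alpha:
  assumes lam: "is_partition lam" and m: "m \<in> rem_rows lam"
  defines "w \<equiv> down_point lam m" and "z \<equiv> outer_pt lam m"
  shows "var_t ^ (m - 1) * alpha lam (remove_cell lam m) = - ((1 - var_q) * (1 - var_t) * w * z / var_t) *
      ((\<Prod>b\<in>rem_rows lam - {m}. w - outer_pt lam b) / (\<Prod>a\<in>add_rows lam. w - inner_pt lam a))"
    and "var_t ^ (m - 1) * alpha_bar lam (remove_cell lam m) = - ((1 - var_q) * (1 - var_t) * z\<^sup>2 / var_t) *
      ((\<Prod>b\<in>rem_rows lam - {m}. z - outer_pt lam b) / (\<Prod>a\<in>add_rows lam. z - inner_pt lam a))"
proof -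
  let ?\<mu> = "remove_cell lam m"
  have m1: "1 \<le> m" and c: "lam m = Suc (?\<mu> m)" using m by (auto simp: rem_rows_def)
  have e: "lam = add_cell ?\<mu> m" using add_remove_cell[OF m] by simp
  have p: "is_partition ?\<mu>"
    using is_partition_remove_cell[OF lam m1 e] m by simp
  note A = alpha_eq_boundary_prod[OF p lam m1 e c disjI2[OF refl]]
  have w: "w = var_t ^ m / var_q ^ lam m" and z: "z = w * var_t / var_q"
    and iw: "inner_pt lam m = w / var_q" and tw: "monom_pt (lam m) (Suc m) = w * var_t"
    by (simp_all add: w_def z_def down_point_def outer_pt_def inner_pt_def monom_pt_def mult.commute)
  \<comment> \<open>The two exceptional factors of the boundary product give the numerator of \<open>\<eta>\<close> up to sign and a monomial.\<close>
  have "(w - inner_pt lam m) * (w - monom_pt (lam m) (Suc m))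
      = - ((1 - var_q) * (1 - var_t) * w * z / var_t)"
    unfolding iw tw z by (simp add: field_simps)
  then show "var_t ^ (m - 1) * alpha lam ?\<mu> = - ((1 - var_q) * (1 - var_t) * w * z / var_t) *
      ((\<Prod>b\<in>rem_rows lam - {m}. w - outer_pt lam b) / (\<Prod>a\<in>add_rows lam. w - inner_pt lam a))"
    using boundary_prod_removable[OF lam m, of w "lam m" m]
    unfolding A(1) by (simp add: w_def down_point_def inner_pt_def)
  have "(z - inner_pt lam m) * (z - monom_pt (lam m) (Suc m))
      = - ((1 - var_q) * (1 - var_t) * z\<^sup>2 / var_t)"
    unfolding iw tw z by (simp add: field_simps power2_eq_square)
  then show "var_t ^ (m - 1) * alpha_bar lam ?\<mu> = - ((1 - var_q) * (1 - var_t) * z\<^sup>2 / var_t) *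
      ((\<Prod>b\<in>rem_rows lam - {m}. z - outer_pt lam b) / (\<Prod>a\<in>add_rows lam. z - inner_pt lam a))"
    using boundary_prod_removable[OF lam m, of z "Suc (lam m)" "Suc m"]
    unfolding A(2) by (simp add: z_def outer_pt_def inner_pt_def)
qed

lemma remove_cell_neq: "m \<in> rem_rows lam \<Longrightarrow> remove_cell lam m \<noteq> lam"
  by (metis add_remove_cell fun_upd_same n_not_Suc_n)

lemma skew_remove_cell:
  assumes "m \<in> rem_rows lam"
  shows "skew_row lam (remove_cell lam m) = int m" "skew_col lam (remove_cell lam m) = int (lam m)"
proof -
  have m1: "1 \<le> m" and c: "Suc (remove_cell lam m m) = lam m" using assms by (auto simp: rem_rows_def)
  show "skew_row lam (remove_cell lam m) = int m" "skew_col lam (remove_cell lam m) = int (lam m)"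
    using skew_add_cell[OF m1, of "remove_cell lam m"] unfolding add_remove_cell[OF assms] c by simp_all
qed

lemma P_stay:
  assumes "1 \<le> r"
  shows "P_fwd lam lam (add_cell lam r) = var_t ^ (r - 1) * alpha (add_cell lam r) lam"
    and "P_bwd lam lam (add_cell lam r) = var_t ^ (r - 1) * alpha_bar (add_cell lam r) lam"
proof -
  have "int r - 1 = int (r - 1)" using assms by simp
  then have "var_t powi (int r - 1) = var_t ^ (r - 1)"
    by (metis power_int_of_nat)
  then show "P_fwd lam lam (add_cell lam r) = var_t ^ (r - 1) * alpha (add_cell lam r) lam"
    "P_bwd lam lam (add_cell lam r) = var_t ^ (r - 1) * alpha_bar (add_cell lam r) lam"
    by (simp_all add: P_fwd_def P_bwd_def skew_add_cell[OF assms])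
qed

section \<open>Transition probabilities and their sums\<close>

text \<open>The two exponents in \<open>\<eta>\<close> are the coordinate differences between the added cell and, respectively, the
removed cell and its diagonal neighbour. So \<open>\<eta>\<close> has its poles at the corresponding points.\<close>

lemma P_move:
  assumes r: "1 \<le> r" and m: "m \<in> rem_rows lam"
  defines "\<nu> \<equiv> add_cell lam r" and "\<mu> \<equiv> remove_cell lam m" and "y \<equiv> inner_pt lam r"
  defines "h \<equiv> (1 - var_q) * (1 - var_t) / (var_t * ((1 - y / down_point lam m) * (1 - y / outer_pt lam m)))"
  shows "P_fwd lam \<mu> \<nu> = (var_t ^ (r - 1) * alpha \<nu> lam) / (var_t ^ (m - 1) * alpha lam \<mu>) * h"
    and "P_bwd lam \<mu> \<nu> = (var_t ^ (r - 1) * alpha_bar \<nu> lam) / (var_t ^ (m - 1) * alpha_bar lam \<mu>) * h"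
proof -
  have m1: "1 \<le> m" using m by (simp add: rem_rows_def)
  have t: "var_t powi (int r - int m - 1) = var_t ^ (r - 1) / var_t ^ (m - 1) / var_t"
  proof -
    have "int r - int m - 1 = int (r - 1) - int (m - 1) - 1"
      using r m1 by simp
    then show ?thesis
      by (simp only: power_int_diff var_nonzero power_int_of_nat power_int_1_right simp_thms)
  qed
  have "var_q powi (int (lam m) - int (Suc (lam r))) * var_t powi (int r - int m) = y / down_point lam m"
    by (simp add: power_int_diff y_def inner_pt_def down_point_def monom_pt_def del: of_nat_Suc)
  moreover have "var_q powi (int (lam m) - int (Suc (lam r)) + 1) * var_t powi (int r - int m - 1)
      = y / outer_pt lam m"
    by (simp add: power_int_diff power_int_add y_def inner_pt_def outer_pt_def monom_pt_def mult.commute del: of_nat_Suc)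
  ultimately have "eta \<nu> lam \<mu> = (1 - var_q) * (1 - var_t)
      / ((1 - y / down_point lam m) * (1 - y / outer_pt lam m))"
    unfolding eta_def Let_def \<nu>_def \<mu>_def skew_add_cell[OF r] skew_remove_cell[OF m] by simp
  then have h: "h = eta \<nu> lam \<mu> / var_t"
    by (simp add: h_def)
  show "P_fwd lam \<mu> \<nu> = (var_t ^ (r - 1) * alpha \<nu> lam) / (var_t ^ (m - 1) * alpha lam \<mu>) * h"
    "P_bwd lam \<mu> \<nu> = (var_t ^ (r - 1) * alpha_bar \<nu> lam) / (var_t ^ (m - 1) * alpha_bar lam \<mu>) * h"
    using remove_cell_neq[OF m]
    unfolding P_fwd_def P_bwd_def h \<mu>_def \<nu>_def skew_add_cell[OF r] skew_remove_cell[OF m] t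
    by simp_all
qed

lemma inj_on_inner_pt: "inj_on (inner_pt lam) A"
  by (simp add: inj_on_def inner_pt_def)

lemma inj_on_outer_pt: "inj_on (outer_pt lam) A"
  by (simp add: inj_on_def outer_pt_def)

text \<open>These differences occur in denominators. The cell of an inner point is outside the diagram and that
of a down point inside. The row above a removable cell is too short for the diagonal neighbour of this
cell to be its first empty cell, and two diagonal neighbours differ because the cells themselves do.\<close>

lemma points_distinct:
  assumes m: "m \<in> rem_rows lam"
  shows "down_point lam m \<noteq> inner_pt lam a"
    and "outer_pt lam m \<noteq> inner_pt lam a"
    and "outer_pt lam m \<noteq> up_point lam a"
  using m by (auto simp: down_point_def inner_pt_def outer_pt_def up_point_def rem_rows_def)

lemma sum_P_fwd_stay:
  assumes lam: "is_partition lam"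
  shows "(\<Sum>\<nu>\<in>up_set lam. P_fwd lam lam \<nu>) = 1"
proof -
  have "(\<Sum>\<nu>\<in>up_set lam. P_fwd lam lam \<nu>) = (\<Sum>r\<in>add_rows lam. P_fwd lam lam (add_cell lam r))"
    unfolding up_set_eq[OF lam] by (subst sum.reindex[OF inj_add_cell]) simp
  also have "\<dots> = (\<Sum>r\<in>add_rows lam. (\<Prod>b\<in>rem_rows lam. inner_pt lam r - outer_pt lam b)
        / (\<Prod>a\<in>add_rows lam - {r}. inner_pt lam r - inner_pt lam a))"
    using up_alpha(1)[OF lam] by (intro sum.cong) (simp_all add: P_stay add_rows_def)
  also have "\<dots> = 1"
    by (intro interlacing_sum finite_add_rows finite_rem_rows card_add_rows inj_on_inner_pt lam)
  finally show ?thesis .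
qed

text \<open>The poles of \<open>\<eta>\<close> at the removed cell and at its diagonal neighbour replace the zero of the boundary
product at the latter by a pole at the former. The interpolation sum is then, up to sign, the value at
this new node, which agrees with \<open>\<alpha>\<close> for the removed cell up to an explicit factor.\<close>

lemma sum_P_fwd_move:
  assumes lam: "is_partition lam" and m: "m \<in> rem_rows lam"
  shows "(\<Sum>\<nu>\<in>up_set lam. P_fwd lam (remove_cell lam m) \<nu>) = 1"
proof -
  let ?\<mu> = "remove_cell lam m" and ?y = "inner_pt lam"
  define w where "w = down_point lam m"
  define z where "z = outer_pt lam m"
  define L where "L r = (\<Prod>b\<in>rem_rows lam. ?y r - outer_pt lam b)
        / (\<Prod>a\<in>add_rows lam - {r}. ?y r - ?y a)" for r
  define R where "R = (\<Prod>b\<in>rem_rows lam - {m}. w - outer_pt lam b) / (\<Prod>a\<in>add_rows lam. w - ?y a)"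
  define D where "D = var_t ^ (m - 1) * alpha lam ?\<mu>"
  define k where "k = (1 - var_q) * (1 - var_t) * w * z / var_t"
  have D: "D = - k * R"
    using down_alpha(1)[OF lam m] by (simp add: D_def k_def R_def w_def z_def)
  have "is_partition ?\<mu>"
    using m down_set_eq[OF lam] by (auto simp: down_set_def covered_by_def)
  then have D0: "D \<noteq> 0"
    by (simp add: D_def alpha_nonzero)
  have wz: "w \<noteq> 0" "z \<noteq> 0" by (simp_all add: w_def z_def down_point_def outer_pt_def)
  have "(\<Sum>\<nu>\<in>up_set lam. P_fwd lam ?\<mu> \<nu>) = (\<Sum>r\<in>add_rows lam. P_fwd lam ?\<mu> (add_cell lam r))"
    unfolding up_set_eq[OF lam] by (subst sum.reindex[OF inj_add_cell]) simp
  also have "\<dots> = (\<Sum>r\<in>add_rows lam. k / D * (L r / ((?y r - w) * (?y r - z))))"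
  proof (rule sum.cong)
    fix r assume r: "r \<in> add_rows lam"
    then have r1: "1 \<le> r" by (simp add: add_rows_def)
    have "1 - ?y r / w = (w - ?y r) / w" "1 - ?y r / z = (z - ?y r) / z"
      using wz by (simp_all add: diff_divide_distrib)
    then have "P_fwd lam ?\<mu> (add_cell lam r)
      = L r / D * ((1 - var_q) * (1 - var_t) / (var_t * ((w - ?y r) / w * ((z - ?y r) / z))))"
      using P_move(1)[OF r1 m] up_alpha(1)[OF lam r] by (simp add: D_def L_def w_def z_def)
    also have "\<dots> = k / D * (L r / ((w - ?y r) * (z - ?y r)))"
      by (simp add: k_def mult_ac)
    also have "(w - ?y r) * (z - ?y r) = (?y r - w) * (?y r - z)"
      by (simp add: algebra_simps)
    finally show "P_fwd lam ?\<mu> (add_cell lam r) = k / D * (L r / ((?y r - w) * (?y r - z)))" .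
  qed simp
  also have "\<dots> = k / D * (\<Sum>r\<in>add_rows lam. L r / ((?y r - w) * (?y r - z)))"
    by (simp add: sum_distrib_left)
  also have "(\<Sum>r\<in>add_rows lam. L r / ((?y r - w) * (?y r - z))) = - R"
    unfolding L_def R_def z_def
    by (rule interlacing_sum_removed)
      (use points_distinct[OF m] in \<open>auto simp: finite_add_rows finite_rem_rows card_add_rows
        inj_on_inner_pt lam m w_def\<close>)
  also have "k / D * - R = 1"
    using D D0 by simp
  finally show ?thesis .
qed

text \<open>Here the roles are exchanged: the nodes are the outer points of the removable cells, together with the
point \<open>x\<close> at which the barred product of the added cell is evaluated. After division by the probability of
staying at \<open>\<lambda>\<close>, the sum is a partial fraction expansion of the inverse of that probability.\<close>

lemma sum_P_bwd:
  assumes lam: "is_partition lam" and r: "r \<in> add_rows lam"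
  shows "(\<Sum>\<mu>\<in>down_star lam. P_bwd lam \<mu> (add_cell lam r)) = 1"
proof -
  let ?\<nu> = "add_cell lam r" and ?A = "add_rows lam" and ?B = "rem_rows lam"
    and ?y = "inner_pt lam" and ?z = "outer_pt lam"
  have r1: "1 \<le> r" using r by (simp add: add_rows_def)
  define x where "x = up_point lam r"
  define L where "L = (\<Prod>b\<in>?B. x - ?z b) / (\<Prod>a\<in>?A - {r}. x - ?y a)"
  define T where "T m = (\<Prod>a\<in>?A - {r}. ?z m - ?y a) / ((\<Prod>b\<in>?B - {m}. ?z m - ?z b) * (?z m - x))" for m
  have fin: "finite ?A" "finite ?B" using lam by (simp_all add: finite_add_rows finite_rem_rows)
  have stay: "P_bwd lam lam ?\<nu> = L"
    using up_alpha(2)[OF lam r] by (simp add: P_stay[OF r1] L_def x_def)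
  have L0: "L \<noteq> 0"
    using alpha_nonzero(2)[OF lam, of ?\<nu>] stay by (auto simp: P_stay[OF r1])
  have move: "P_bwd lam (remove_cell lam m) ?\<nu> = - L * T m" if m: "m \<in> ?B" for m
  proof -
    let ?\<mu> = "remove_cell lam m"
    define z where "z = ?z m"
    define R where "R = (\<Prod>b\<in>?B - {m}. z - ?z b) / (\<Prod>a\<in>?A. z - ?y a)"
    define k where "k = (1 - var_q) * (1 - var_t)"
    have z0: "z \<noteq> 0" by (simp add: z_def outer_pt_def)
    have zy: "z - ?y r \<noteq> 0" and zx: "z - x \<noteq> 0"
      using points_distinct[OF m, of r] by (auto simp: z_def x_def)
    have k0: "k \<noteq> 0"
      using one_minus_monom_nonzero[of 1 0] one_minus_monom_nonzero[of 0 1] by (simp add: k_def)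
    have D: "var_t ^ (m - 1) * alpha_bar lam ?\<mu> = - (k * z\<^sup>2 / var_t) * R"
      using down_alpha(2)[OF lam m] by (simp add: R_def z_def k_def)
    \<comment> \<open>One pole of \<open>\<eta>\<close> becomes the pole at \<open>x\<close> after a diagonal shift of both points, and the other cancels the factor of \<open>r\<close> in the product over addable rows.\<close>
    have "?y r / down_point lam m = x / z"
      by (simp add: x_def z_def inner_pt_def down_point_def up_point_def outer_pt_def monom_pt_def)
    then have "1 - ?y r / down_point lam m = (z - x) / z" "1 - ?y r / z = (z - ?y r) / z"
      using z0 by (simp_all add: diff_divide_distrib)
    then have "P_bwd lam ?\<mu> ?\<nu> = L / (- (k * z\<^sup>2 / var_t) * R)
        * (k / (var_t * ((z - x) / z * ((z - ?y r) / z))))"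
      using P_move(2)[OF r1 m] up_alpha(2)[OF lam r] D by (simp add: L_def x_def z_def k_def)
    also have "\<dots> = - L / (R * (z - x) * (z - ?y r))"
      using z0 k0 zx zy by (simp add: power2_eq_square)
    also have "\<dots> = - L * T m"
    proof -
      have "(\<Prod>a\<in>?A. z - ?y a) = (z - ?y r) * (\<Prod>a\<in>?A - {r}. z - ?y a)"
        by (rule prod.remove[OF fin(1) r])
      then show ?thesis using zy by (simp add: R_def T_def z_def)
    qed
    finally show ?thesis .
  qed
  have "down_star lam = insert lam (remove_cell lam ` ?B)"
    by (simp add: down_star_def down_set_eq[OF lam])
  moreover have "lam \<notin> remove_cell lam ` ?B"
  proof
    assume "lam \<in> remove_cell lam ` ?B"
    then obtain m where m: "lam = remove_cell lam m" "m \<in> ?B"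
      by (rule imageE)
    show False
      by (rule notE[OF remove_cell_neq[OF m(2)] m(1)[symmetric]])
  qed
  ultimately have "(\<Sum>\<mu>\<in>down_star lam. P_bwd lam \<mu> ?\<nu>)
      = P_bwd lam lam ?\<nu> + (\<Sum>m\<in>?B. P_bwd lam (remove_cell lam m) ?\<nu>)"
    using fin sum.reindex[OF inj_remove_cell, of "\<lambda>\<mu>. P_bwd lam \<mu> ?\<nu>" lam]
    by (simp only: sum.insert finite_imageI comp_def simp_thms)
  also have "\<dots> = L * (1 - (\<Sum>m\<in>?B. T m))"
    using stay move by (simp add: sum_distrib_left sum_negf right_diff_distrib)
  also have "1 - (\<Sum>m\<in>?B. T m) = (\<Prod>a\<in>?A - {r}. x - ?y a) / (\<Prod>b\<in>?B. x - ?z b)"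
    unfolding T_def
  proof (rule interlacing_partial_fractions[symmetric])
    show "card (?A - {r}) = card ?B"
      using r card_add_rows[OF lam] by simp
    show "x \<notin> ?z ` ?B"
      using points_distinct(3)[of _ lam r] by (auto simp: x_def dest: sym)
  qed (simp_all add: fin inj_on_outer_pt)
  also have "L * \<dots> = 1"
    using L0 by (simp add: L_def)
  finally show ?thesis .
qed

theorem theorem4p4:
  fixes lam :: parts
  assumes "is_partition lam"
  shows "(\<forall>\<mu>\<in>down_star lam. (\<Sum>\<nu>\<in>up_set lam. P_fwd lam \<mu> \<nu>) = 1) \<and>
         (\<forall>\<nu>\<in>up_set lam. (\<Sum>\<mu>\<in>down_star lam. P_bwd lam \<mu> \<nu>) = 1) \<and>
         (\<forall>\<mu>\<in>down_star lam. \<forall>\<nu>\<in>up_set lam.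
            weight_down lam \<mu> * P_fwd lam \<mu> \<nu> = P_bwd lam \<mu> \<nu> * weight_up lam \<nu>) \<and>
         probabilistic_bijection (down_star lam) (weight_down lam)
           (up_set lam) (weight_up lam) (P_fwd lam) (P_bwd lam)"
proof -
  have down: "down_star lam = insert lam (remove_cell lam ` rem_rows lam)"
    using assms by (simp add: down_star_def down_set_eq)
  have fwd: "\<forall>\<mu>\<in>down_star lam. (\<Sum>\<nu>\<in>up_set lam. P_fwd lam \<mu> \<nu>) = 1"
    unfolding down using sum_P_fwd_stay[OF assms] sum_P_fwd_move[OF assms] by blast
  have bwd: "\<forall>\<nu>\<in>up_set lam. (\<Sum>\<mu>\<in>down_star lam. P_bwd lam \<mu> \<nu>) = 1"
    unfolding up_set_eq[OF assms] using sum_P_bwd[OF assms] by blast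
  have "is_partition \<mu>" if "\<mu> \<in> down_star lam" for \<mu>
    using that assms by (auto simp: down_star_def down_set_def covered_by_def)
  then have bal: "\<forall>\<mu>\<in>down_star lam. \<forall>\<nu>\<in>up_set lam.
      weight_down lam \<mu> * P_fwd lam \<mu> \<nu> = P_bwd lam \<mu> \<nu> * weight_up lam \<nu>"
    using detailed_balance[OF assms] by blast
  have "finite (down_star lam)" "finite (up_set lam)"
    using assms by (simp_all add: down up_set_eq finite_add_rows finite_rem_rows)
  then show ?thesis
    unfolding probabilistic_bijection_def using fwd bwd bal by blast
qed

end
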